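(* Let $\Lambda\subset\mathbb{R}^3$ be a bounded, connected, open set, independent of $N$. Let $U_\Lambda\ge 0$ be a pair potential which is symmetric, $U_\Lambda(\check q,\hat q)=U_\Lambda(\hat q,\check q)$; which is (real-valued and) continuous on $\overline\Lambda\times\overline\Lambda$; and which satisfies $U_\Lambda(\check q,\hat q)=+\infty$ whenever $\check q\notin\overline\Lambda$ or $\hat q\notin\overline\Lambda$. Let $$H^{(N)}_\Lambda(p_1,\dots,q_N)=N\sum_{1\le i\le N}\tfrac12|p_i|^2+\sum_{1\le i<j\le N}U_\Lambda(q_i,q_j),$$ let $S_{H^{(N)}_\Lambda}(\mathcal E)=\ln\Omega'_{H^{(N)}_\Lambda}(\mathcal E)$ be the ergodic ensemble entropy, and let $\varepsilon>\varepsilon_g$. Then, as $N\to\infty$, $$S_{H^{(N)}_\Lambda}(N^2\varepsilon)=-N\ln N+N\,s_\Lambda(\varepsilon)+o(N)$$ for some real number $s_\Lambda(\varepsilon)$ independent of $N$ (the system-specific Boltzmann entropy per particle). The function $\varepsilon\mapsto s_\Lambda(\varepsilon)$ is continuous and strictly increasing for $\varepsilon>\varepsilon_g$.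
   Context: For $\mathcal E\in\mathbb{R}$, $$\Omega_{H^{(N)}_\Lambda}(\mathcal E)=\frac1{N!}\int\chi_{\{H^{(N)}_\Lambda<\mathcal E\}}\,d^{6N}X,$$ where $X=(p_1,q_1;\dots;p_N,q_N)\in(\mathbb{R}^3\times\Lambda)^N$ and $d^{6N}X$ is Lebesgue measure in these variables; $\Omega'_{H^{(N)}_\Lambda}$ is the derivative with respect to $\mathcal E$ (formally $\frac1{N!}\int\delta(\mathcal E-H^{(N)}_\Lambda)\,d^{6N}X$). $$\varepsilon_g=\inf_{\rho\in\mathfrak P(\Lambda)}\iint\tfrac12U_\Lambda(q,\tilde q)\rho(q)\rho(\tilde q)\,d^3q\,d^3\tilde q\ \ (\ge 0),$$ where $\mathfrak P(\Lambda)$ is the set of probability measures on $\Lambda$, written in density notation. *)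

theory Defs
  imports "HOL-Probability.Probability" "HOL-Library.Landau_Symbols"
begin

text \<open>
  A phase point is a function \<open>X\<close> on the particle labels \<open>{1..N}\<close>, with \<open>X i = (p\<^sub>i, q\<^sub>i)\<close>.
\<close>

definition hamiltonian ::
    "(real^3 \<Rightarrow> real^3 \<Rightarrow> ereal) \<Rightarrow> nat \<Rightarrow> (nat \<Rightarrow> (real^3) \<times> (real^3)) \<Rightarrow> ereal" where
  "hamiltonian U N X =
     ereal (real N * (\<Sum>i\<in>{1..N}. (norm (fst (X i)))\<^sup>2 / 2)) +
     (\<Sum>i\<in>{1..N}. \<Sum>j\<in>{i<..N}. U (snd (X i)) (snd (X j)))"

text \<open>
  Positions range over \<open>\<Lambda>\<close> itself; this has to be imposed separately from \<open>U = \<infinity>\<close> off the closure,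
  since the boundary of \<open>\<Lambda>\<close> may have positive volume.
\<close>

definition phase_volume ::
    "(real^3) set \<Rightarrow> (real^3 \<Rightarrow> real^3 \<Rightarrow> ereal) \<Rightarrow> nat \<Rightarrow> real \<Rightarrow> real" where
  "phase_volume \<Lambda> U N E =
     1 / fact N *
       (LINT X : (\<Pi>\<^sub>E i\<in>{1..N}. UNIV \<times> \<Lambda>) | (\<Pi>\<^sub>M i\<in>{1..N}. lborel).
          indicator {X. hamiltonian U N X < ereal E} X)"

definition ergodic_entropy ::
    "(real^3) set \<Rightarrow> (real^3 \<Rightarrow> real^3 \<Rightarrow> ereal) \<Rightarrow> nat \<Rightarrow> real \<Rightarrow> real" where
  "ergodic_entropy \<Lambda> U N E = ln (deriv (phase_volume \<Lambda> U N) E)"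

definition prob_measures_on :: "(real^3) set \<Rightarrow> (real^3) measure set" where
  "prob_measures_on \<Lambda> = {\<mu>. prob_space \<mu> \<and> sets \<mu> = sets (restrict_space borel \<Lambda>)}"

text \<open>
  The infimum is over all probability measures, not only those with a density. It is taken in
  \<open>ereal\<close>, so that it is \<open>\<infinity>\<close> rather than unspecified if \<open>\<Lambda>\<close> is empty.
\<close>

definition ground_energy :: "(real^3) set \<Rightarrow> (real^3 \<Rightarrow> real^3 \<Rightarrow> ereal) \<Rightarrow> ereal" where
  "ground_energy \<Lambda> U =
     (INF \<mu>\<in>prob_measures_on \<Lambda>.
        enn2ereal (\<integral>\<^sup>+ q. \<integral>\<^sup>+ q'. e2ennreal (1 / 2 * U q q') \<partial>\<mu> \<partial>\<mu>))"

end

theory Submission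
  imports Defs "HOL-Real_Asymp.Real_Asymp"
begin

text \<open>
  Integrating out the momenta turns \<open>phase_volume\<close> into an explicit constant times the moment
  \<open>\<integral> max 0 (\<epsilon> - v\<^sub>N)\<^bsup>3N/2\<^esup>\<close>, where \<open>v\<^sub>N\<close> is the potential energy divided by \<open>N\<^sup>2\<close> and the positions
  are independent and uniform in \<open>\<Lambda>\<close>. The derivative lowers the exponent by one, so it remains to
  see that \<open>1/N\<close> times the logarithm of this moment converges.

  Round positions to finitely many cells, so that up to a small error \<open>v\<^sub>N\<close> depends only on the
  fractions of particles in each cell. There are polynomially many occupation patterns, so one of
  them carries the moment up to a subexponential factor. Putting independent copies of that pattern
  side by side leaves the fractions, hence the energy, unchanged: this makes the moments
  almost supermultiplicative without any convexity of the interaction. Together with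
  equicontinuity in \<open>\<epsilon>\<close> this yields the limit, its continuity and its strict monotonicity.
\<close>

section \<open>Gamma asymptotics and a convergence criterion\<close>

text \<open>The interaction has no convexity and the law of the potential energy need not have a
  density, so the momenta must supply all regularity. The integrand
  \<open>max 0 (e - v) powr a\<close>, with \<open>a\<close> about \<open>3N/2\<close>, is
  differentiable in \<open>e\<close> as soon as \<open>a > 1\<close>, and its exponents add up over
  blocks of particles.

  It also makes nearby levels comparable. Where \<open>e - v > c\<close>, lowering \<open>e\<close>
  by \<open>d < c\<close> costs at most a factor \<open>(1 - d / c) powr a\<close>. The remaining
  part contributes at most \<open>c powr a\<close>, which is negligible once \<open>c\<close> is a
  small enough constant. After taking \<open>1/N\<close> of the logarithm the cost is about
  \<open>3/2 * ln (1 - d / c)\<close>, uniformly in \<open>N\<close>.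

  This is what rescues the limit: superadditivity compares two different energy levels, because
  rounding and leftover particles shift the level by a multiple of \<delta>, and the shift is
  absorbed by equicontinuity before \<delta> is made small. A second mismatch is mild: blocks
  multiply at exponent \<open>3N/2\<close> while the derivative carries \<open>3N/2 - 1\<close>, and
  the two moments differ by factors that do not grow exponentially.\<close>

lemma convergent_if_almost_increasing:
  fixes x :: "nat \<Rightarrow> real"
  assumes bdd: "eventually (\<lambda>n. \<bar>x n\<bar> \<le> C) sequentially"
    and incr: "\<And>\<eta>. \<eta> > 0 \<Longrightarrow> eventually (\<lambda>n. eventually (\<lambda>m. x n - \<eta> \<le> x m) sequentially) sequentially"
  shows "convergent x"
proof -
  define lo where "lo = liminf (\<lambda>n. ereal (x n))"
  define hi where "hi = limsup (\<lambda>n. ereal (x n))"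
  \<comment> \<open>The hypothesis puts \<open>x n - \<eta>\<close> below the liminf for all large
    \<open>n\<close>. This stands in for Fekete's lemma when superadditivity carries losses.\<close>
  have "hi \<le> lo + ereal \<eta>" if "\<eta> > 0" for \<eta>
  proof -
    have "eventually (\<lambda>n. ereal (x n) \<le> lo + ereal \<eta>) sequentially"
      using incr[OF that]
    proof eventually_elim
      case (elim n)
      have "ereal (x n - \<eta>) \<le> lo"
        unfolding lo_def by (rule Liminf_bounded) (use elim in auto)
      then have "ereal (x n - \<eta>) + ereal \<eta> \<le> lo + ereal \<eta>" by (rule add_right_mono)
      then show ?case by simp
    qed
    then show ?thesis unfolding hi_def by (rule Limsup_bounded)
  qed
  then have "hi \<le> lo" by (blast intro: ereal_le_epsilon2)
  moreover have "lo \<le> hi" unfolding lo_def hi_def by (rule Liminf_le_Limsup) simp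
  ultimately have eq: "lo = hi" by simp
  have "ereal (-C) \<le> lo" unfolding lo_def
    by (rule Liminf_bounded) (use bdd in eventually_elim, auto)
  moreover have "hi \<le> ereal C" unfolding hi_def
    by (rule Limsup_bounded) (use bdd in eventually_elim, auto)
  ultimately obtain l where l: "lo = ereal l"
    using eq by (cases lo) auto
  have "(\<lambda>n. ereal (x n)) \<longlonglongrightarrow> ereal l"
    using eq l by (subst tendsto_iff_Liminf_eq_Limsup) (auto simp: lo_def hi_def)
  then show ?thesis by (auto simp: convergent_def)
qed

text \<open>Only the part \<open>t \<ge> x\<close> of the Euler integral is kept. There
  \<open>t powr x\<close> is at least \<open>x powr x\<close>, and the exponential tail integrates
  to \<open>exp (-x)\<close>.\<close>

lemma Gamma_lower_bound:
  fixes x :: real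
  assumes "x > 0"
  shows "x powr x * exp (-x) \<le> Gamma (x + 1)"
proof -
  have "((\<lambda>t. exp (- 1 * t)) has_integral exp (- 1 * x) / 1) {x..}"
    by (rule has_integral_exp_minus_to_infinity) simp
  then have "((\<lambda>t. x powr x * exp (- t)) has_integral x powr x * exp (- x)) {x..}"
    by (intro has_integral_mult_right) simp
  then have "((\<lambda>t. if t \<in> {x..} then x powr x * exp (- t) else 0) has_integral x powr x * exp (- x)) {0..}"
    using assms by (subst has_integral_restrict) auto
  moreover have "((\<lambda>t. t powr (x + 1 - 1) / exp t) has_integral Gamma (x + 1)) {0..}"
    using assms by (intro Gamma_integral_real) auto
  ultimately show ?thesis
    by (rule has_integral_le) (use assms in \<open>auto simp: exp_minus divide_inverse intro!: powr_mono2\<close>)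
qed

text \<open>The inequality \<open>ln y \<le> y - 1\<close> at
  \<open>y = (x - 1) * t / x\<^sup>2\<close> bounds the exponent \<open>x * ln t - t\<close> by a
  line in \<open>t\<close> of slope \<open>- 1 / x\<close>, and the resulting exponential integrates
  to \<open>x\<close> times a constant. For large \<open>x\<close> the bound exceeds
  \<open>x * ln x - x\<close> in the exponent only by a bounded amount.\<close>

lemma Gamma_upper_bound:
  fixes x :: real
  assumes "x > 1"
  shows "Gamma (x + 1) \<le> x * exp (2 * x * ln x - x * ln (x - 1) - x)"
proof -
  define C where "C = exp (2 * x * ln x - x * ln (x - 1) - x)"
  have "((\<lambda>t. exp (- (1 / x) * t)) has_integral exp (- (1 / x) * 0) / (1 / x)) {0..}"
    by (rule has_integral_exp_minus_to_infinity) (use assms in simp)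
  then have "((\<lambda>t. C * exp (- (1 / x) * t)) has_integral C * x) {0..}"
    by (intro has_integral_mult_right) simp
  with Gamma_integral_real[of "x + 1"] have "Gamma (x + 1) \<le> C * x"
  proof (rule has_integral_le)
    fix t :: real assume "t \<in> {0..}"
    show "t powr (x + 1 - 1) / exp t \<le> C * exp (- (1 / x) * t)"
    proof (cases "t = 0")
      case False
      with \<open>t \<in> {0..}\<close> have t: "t > 0" by auto
      have "ln ((x - 1) * t / x\<^sup>2) \<le> (x - 1) * t / x\<^sup>2 - 1"
        using assms t by (intro ln_le_minus_one) auto
      then have "x * ln ((x - 1) * t / x\<^sup>2) \<le> x * ((x - 1) * t / x\<^sup>2 - 1)"
        using assms by (intro mult_left_mono) auto
      also have "\<dots> = t - 1 / x * t - x"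
        using assms by (simp add: field_simps power2_eq_square)
      also have "ln ((x - 1) * t / x\<^sup>2) = ln (x - 1) + ln t - 2 * ln x"
        using assms t by (simp add: ln_div ln_mult ln_realpow)
      finally have "x * ln t - t \<le> (2 * x * ln x - x * ln (x - 1) - x) - 1 / x * t"
        by (simp add: algebra_simps)
      then have "exp (x * ln t - t) \<le> exp ((2 * x * ln x - x * ln (x - 1) - x) - 1 / x * t)"
        by simp
      moreover have "exp (x * ln t - t) = t powr (x + 1 - 1) / exp t"
        using t by (simp add: powr_def exp_diff)
      moreover have "exp ((2 * x * ln x - x * ln (x - 1) - x) - 1 / x * t) = C * exp (- (1 / x) * t)"
        by (simp add: C_def flip: exp_add)
      ultimately show ?thesis by simp
    qed (use assms in \<open>auto simp: C_def\<close>)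
  qed (use assms in auto)
  then show ?thesis by (simp add: C_def mult.commute)
qed

text \<open>Stirling to order \<open>o(x)\<close>, the accuracy of the entropy expansion. It is
  applied at \<open>x = N\<close> for the factorial and at \<open>x = 3N/2\<close> for the volume of
  the kinetic-energy ball.\<close>

lemma ln_Gamma_asymp:
  "((\<lambda>x. (ln (Gamma (x + 1)) - x * ln x + x) / x) \<longlongrightarrow> (0::real)) at_top"
proof (rule tendsto_sandwich)
  show "\<forall>\<^sub>F x in at_top. 0 \<le> (ln (Gamma (x + 1)) - x * ln x + x) / (x::real)"
    using eventually_gt_at_top[of 0]
  proof eventually_elim
    case (elim x)
    have "ln (x powr x * exp (-x)) \<le> ln (Gamma (x + 1))"
      using Gamma_lower_bound[OF elim] elim by (subst ln_le_cancel_iff) (auto intro: Gamma_real_pos)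
    then show ?case using elim by (simp add: ln_mult ln_powr)
  qed
  show "\<forall>\<^sub>F x in at_top. (ln (Gamma (x + 1)) - x * ln x + x) / x
       \<le> (ln x + x * ln x - x * ln (x - 1)) / (x::real)"
    using eventually_gt_at_top[of 1]
  proof eventually_elim
    case (elim x)
    have "ln (Gamma (x + 1)) \<le> ln (x * exp (2 * x * ln x - x * ln (x - 1) - x))"
      using Gamma_upper_bound[OF elim] elim by (subst ln_le_cancel_iff) (auto intro: Gamma_real_pos)
    also have "\<dots> = ln x + (2 * x * ln x - x * ln (x - 1) - x)"
      using elim by (simp add: ln_mult)
    finally show ?case using elim by (intro divide_right_mono) auto
  qed
  show "((\<lambda>x. (ln x + x * ln x - x * ln (x - 1)) / (x::real)) \<longlongrightarrow> 0) at_top" by real_asymp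
qed simp

section \<open>Moments of truncated variables\<close>

text \<open>Since \<open>0 powr a = 0\<close> even for \<open>a = 0\<close>, only points with
  \<open>v x < e\<close> contribute; at \<open>a = 0\<close> the moment is the probability of that
  event.\<close>

definition truncated_moment :: "'a measure \<Rightarrow> ('a \<Rightarrow> real) \<Rightarrow> real \<Rightarrow> real \<Rightarrow> real" where
  "truncated_moment M v a e = (LINT x|M. max 0 (e - v x) powr a)"

locale nonneg_variable = prob_space M for M :: "'a measure" +
  fixes v :: "'a \<Rightarrow> real"
  assumes measurable_v[measurable]: "v \<in> borel_measurable M"
    and v_nonneg: "\<And>x. x \<in> space M \<Longrightarrow> 0 \<le> v x"
begin

lemma truncated_power_le:
  assumes "x \<in> space M" "0 \<le> a" "0 \<le> e"
  shows "max 0 (e - v x) powr a \<le> e powr a"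
  using assms v_nonneg[of x] by (intro powr_mono2) auto

lemma integrable_truncated_power:
  assumes "0 \<le> a"
  shows "integrable M (\<lambda>x. max 0 (e - v x) powr a)"
proof (rule integrable_const_bound[where B = "max 0 e powr a"])
  show "AE x in M. norm (max 0 (e - v x) powr a) \<le> max 0 e powr a"
    using assms by (intro AE_I2) (auto intro!: powr_mono2 max.mono dest: v_nonneg)
qed measurable

lemma truncated_moment_nonneg: "0 \<le> truncated_moment M v a e"
  unfolding truncated_moment_def by (rule integral_nonneg_AE) simp

lemma truncated_moment_mono:
  assumes "0 \<le> a" "e \<le> e'"
  shows "truncated_moment M v a e \<le> truncated_moment M v a e'"
  unfolding truncated_moment_def using assms
  by (intro integral_mono integrable_truncated_power powr_mono2) auto

lemma truncated_moment_le:
  assumes "0 \<le> a" "0 \<le> e"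
  shows "truncated_moment M v a e \<le> e powr a"
proof -
  have "truncated_moment M v a e \<le> (LINT x|M. e powr a)"
    unfolding truncated_moment_def using assms
    by (intro integral_mono integrable_truncated_power truncated_power_le) auto
  then show ?thesis by (simp add: prob_space)
qed

text \<open>Stretching \<open>e - v\<close> by \<open>1 + h / e\<close> gives
  \<open>e + h - v\<close> minus \<open>h * v / e\<close>, and \<open>v\<close> is nonnegative. This
  gain, exponential in \<open>a\<close>, is the source of strict monotonicity.\<close>

lemma truncated_moment_scale:
  assumes "0 \<le> a" "0 < e" "0 \<le> h"
  shows "(1 + h / e) powr a * truncated_moment M v a e \<le> truncated_moment M v a (e + h)"
proof -
  have "(1 + h / e) powr a * max 0 (e - v x) powr a \<le> max 0 (e + h - v x) powr a" if "x \<in> space M" for x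
  proof -
    have "(1 + h / e) * max 0 (e - v x) \<le> max 0 (e + h - v x)"
    proof (cases "v x \<le> e")
      case True
      have "(1 + h / e) * (e - v x) = e + h - v x - h * v x / e"
        using assms by (simp add: field_simps)
      also have "\<dots> \<le> e + h - v x"
        using assms v_nonneg[OF that] by simp
      finally show ?thesis using True by simp
    qed auto
    then have "((1 + h / e) * max 0 (e - v x)) powr a \<le> max 0 (e + h - v x) powr a"
      using assms by (intro powr_mono2) auto
    then show ?thesis using assms by (subst (asm) powr_mult) auto
  qed
  then have "(LINT x|M. (1 + h / e) powr a * max 0 (e - v x) powr a) \<le> truncated_moment M v a (e + h)"
    unfolding truncated_moment_def using assms
    by (intro integral_mono integrable_mult_right integrable_truncated_power) auto
  then show ?thesis by (simp add: truncated_moment_def)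
qed

text \<open>Where \<open>e - v\<close> exceeds \<open>c\<close>, subtracting \<open>d\<close>
  shrinks it by a factor no smaller than \<open>1 - d / c\<close>. The other points contribute at
  most \<open>c powr a\<close>, because the total mass is one. This is the reverse of
  \<open>truncated_moment_scale\<close> and the source of equicontinuity.\<close>

lemma truncated_moment_shift:
  assumes "0 \<le> a" "0 \<le> d" "d < c"
  shows "(1 - d / c) powr a * (truncated_moment M v a e - c powr a) \<le> truncated_moment M v a (e - d)"
proof -
  have *: "(1 - d / c) powr a * (max 0 (e - v x) powr a - c powr a) \<le> max 0 (e - d - v x) powr a" for x
  proof (cases "e - v x \<le> c")
    case True
    then have "max 0 (e - v x) powr a \<le> c powr a"
      using assms by (intro powr_mono2) auto
    then have "(1 - d / c) powr a * (max 0 (e - v x) powr a - c powr a) \<le> 0"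
      by (intro mult_nonneg_nonpos) auto
    also have "0 \<le> max 0 (e - d - v x) powr a" by simp
    finally show ?thesis .
  next
    case False
    have "d * 1 \<le> d * ((e - v x) / c)"
      using assms False by (intro mult_left_mono) (auto simp: field_simps)
    also have "\<dots> = (e - v x) - (1 - d / c) * (e - v x)"
      by (simp add: left_diff_distrib)
    finally have "(1 - d / c) * (e - v x) \<le> e - d - v x" by simp
    moreover have "0 \<le> (1 - d / c) * (e - v x)"
      using assms False by (intro mult_nonneg_nonneg) auto
    ultimately have "((1 - d / c) * (e - v x)) powr a \<le> max 0 (e - d - v x) powr a"
      using assms by (intro powr_mono2) auto
    moreover have "((1 - d / c) * (e - v x)) powr a = (1 - d / c) powr a * (e - v x) powr a"
      by (rule powr_mult)
    moreover have "(1 - d / c) powr a * ((e - v x) powr a - c powr a) \<le> (1 - d / c) powr a * (e - v x) powr a"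
      by (intro mult_left_mono) auto
    moreover have "max 0 (e - v x) = e - v x" using assms False by auto
    ultimately show ?thesis by linarith
  qed
  have "(LINT x|M. (1 - d / c) powr a * (max 0 (e - v x) powr a - c powr a)) \<le> truncated_moment M v a (e - d)"
    unfolding truncated_moment_def using assms *
    by (intro integral_mono integrable_mult_right integrable_truncated_power Bochner_Integration.integrable_diff) auto
  moreover have "(LINT x|M. (1 - d / c) powr a * (max 0 (e - v x) powr a - c powr a))
      = (1 - d / c) powr a * (truncated_moment M v a e - c powr a)"
    using assms integrable_truncated_power[of a e] by (simp add: truncated_moment_def prob_space)
  ultimately show ?thesis by linarith
qed

text \<open>One factor \<open>e - v\<close>, at most \<open>e\<close>, is peeled off. With
  \<open>truncated_moment_le_Suc\<close> this passes between the exponent \<open>3N/2\<close> of the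
  phase volume and \<open>3N/2 - 1\<close> of its derivative, at a cost independent of
  \<open>N\<close>.\<close>

lemma truncated_moment_Suc_le:
  assumes "0 \<le> a" "0 \<le> e"
  shows "truncated_moment M v (a + 1) e \<le> e * truncated_moment M v a e"
proof -
  have "max 0 (e - v x) powr (a + 1) \<le> e * max 0 (e - v x) powr a" if "x \<in> space M" for x
    using assms v_nonneg[OF that] by (auto simp: powr_add max_def mult.commute intro: mult_right_mono)
  then have "truncated_moment M v (a + 1) e \<le> (LINT x|M. e * max 0 (e - v x) powr a)"
    unfolding truncated_moment_def using assms
    by (intro integral_mono integrable_mult_right integrable_truncated_power) auto
  then show ?thesis by (simp add: truncated_moment_def)
qed

text \<open>At level \<open>e\<close> the extra factor \<open>e - v\<close> may be arbitrarily
  small; raising the level by \<open>h\<close> first makes it at least \<open>h\<close>.\<close>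

lemma truncated_moment_le_Suc:
  assumes "0 \<le> a" "0 < h"
  shows "h * truncated_moment M v a e \<le> truncated_moment M v (a + 1) (e + h)"
proof -
  have "h * max 0 (e - v x) powr a \<le> max 0 (e + h - v x) powr (a + 1)" if "x \<in> space M" for x
  proof (cases "v x < e")
    case True
    have "h * (e - v x) powr a \<le> (e + h - v x) * (e + h - v x) powr a"
      using assms True by (intro mult_mono powr_mono2) auto
    then show ?thesis using True assms by (simp add: powr_add mult.commute)
  qed (use assms in auto)
  then have "(LINT x|M. h * max 0 (e - v x) powr a) \<le> truncated_moment M v (a + 1) (e + h)"
    unfolding truncated_moment_def using assms
    by (intro integral_mono integrable_mult_right integrable_truncated_power) auto
  then show ?thesis by (simp add: truncated_moment_def)
qed

lemma truncated_moment_pos: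
  assumes "0 \<le> a" "0 < prob {x \<in> space M. v x < e}"
  shows "0 < truncated_moment M v a e"
proof (rule ccontr)
  assume "\<not> ?thesis"
  then have "truncated_moment M v a e = 0"
    using truncated_moment_nonneg[of a e] by simp
  then have "AE x in M. max 0 (e - v x) powr a = 0"
    using integrable_truncated_power[OF \<open>0 \<le> a\<close>] unfolding truncated_moment_def
    by (subst (asm) integral_nonneg_eq_0_iff_AE) auto
  then have "AE x in M. x \<notin> {x \<in> space M. v x < e}"
    by eventually_elim (auto simp: max_def split: if_splits)
  then have "prob {x \<in> space M. v x < e} = 0"
    by (subst prob_eq_0) auto
  with assms show False by simp
qed

end

section \<open>Existence of the exponential rate\<close>

text \<open>In \<open>superadditive\<close>, \<open>n\<close> particles are split into
  \<open>n div N\<close> blocks and \<open>n mod N\<close> leftovers. The term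
  \<open>K * ln (real N + 1)\<close> pays for selecting one of polynomially many occupation
  patterns, \<open>ln \<delta>\<close> for the momenta of the leftovers, and the shift
  \<open>3 * \<delta>\<close> for rounding. The threshold for \<open>N\<close> is uniform in
  \<open>e\<close>, whereas that for \<open>n\<close> may depend on \<open>N\<close> and
  \<open>e\<close>.\<close>

locale moment_sequence =
  fixes M :: "nat \<Rightarrow> 'a measure" and v :: "nat \<Rightarrow> 'a \<Rightarrow> real" and E :: "real set"
  assumes variable: "1 \<le> N \<Longrightarrow> nonneg_variable (M N) (v N)"
    and E_pos: "e \<in> E \<Longrightarrow> 0 < e"
    and E_up: "e \<in> E \<Longrightarrow> e \<le> e' \<Longrightarrow> e' \<in> E"
    and E_down: "e \<in> E \<Longrightarrow> \<exists>d>0. e - d \<in> E"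
    and moment_pos: "e \<in> E \<Longrightarrow> 1 \<le> N \<Longrightarrow> 0 \<le> a \<Longrightarrow> 0 < truncated_moment (M N) (v N) a e"
    and superadditive: "0 < \<delta> \<Longrightarrow> \<exists>K. \<forall>\<^sub>F N in sequentially. \<forall>e\<in>E. \<forall>\<^sub>F n in sequentially.
      real (n div N) * (ln (truncated_moment (M N) (v N) (3 * real N / 2) e) - K * ln (real N + 1))
        + 3 * real (n mod N) / 2 * ln \<delta>
      \<le> ln (truncated_moment (M n) (v n) (3 * real n / 2) (e + 3 * \<delta>))"
begin

text \<open>The exponent is that of the derivative of the phase volume; the explicit prefactors are
  treated separately in \<open>ln_phase_const_asymp\<close>.\<close>

definition rate :: "nat \<Rightarrow> real \<Rightarrow> real" where
  "rate N e = ln (truncated_moment (M N) (v N) (3 * real N / 2 - 1) e) / real N"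

lemma rate_mono:
  assumes "e \<in> E" "e \<le> e'" "1 \<le> N"
  shows "rate N e \<le> rate N e'"
proof -
  interpret nonneg_variable "M N" "v N" using assms by (intro variable)
  show ?thesis unfolding rate_def
    using assms moment_pos[OF E_up[OF assms(1,2)] \<open>1 \<le> N\<close>] moment_pos[OF \<open>e \<in> E\<close> \<open>1 \<le> N\<close>]
    by (intro divide_right_mono ln_mono truncated_moment_mono) auto
qed

lemma rate_upper:
  assumes "e \<in> E" "1 \<le> N"
  shows "rate N e \<le> 3 / 2 * \<bar>ln e\<bar>"
proof -
  interpret nonneg_variable "M N" "v N" using assms by (intro variable)
  have "ln (truncated_moment (M N) (v N) (3 * real N / 2 - 1) e) \<le> ln (e powr (3 * real N / 2 - 1))"
    using assms E_pos[OF \<open>e \<in> E\<close>] moment_pos[OF assms, of "3 * real N / 2 - 1"]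
    by (intro ln_mono truncated_moment_le) auto
  also have "\<dots> = (3 * real N / 2 - 1) * ln e"
    using E_pos[OF \<open>e \<in> E\<close>] by (simp add: ln_powr)
  also have "\<dots> \<le> (3 * real N / 2 - 1) * \<bar>ln e\<bar>"
    using assms by (intro mult_left_mono) auto
  also have "\<dots> \<le> (3 * real N / 2) * \<bar>ln e\<bar>"
    by (intro mult_right_mono) auto
  finally show ?thesis
    using assms by (simp add: rate_def field_simps)
qed

lemma rate_scale:
  assumes "e \<in> E" "1 \<le> N" "0 \<le> h"
  shows "rate N e + (3 / 2 - 1 / real N) * ln (1 + h / e) \<le> rate N (e + h)"
proof -
  interpret nonneg_variable "M N" "v N" using assms by (intro variable)
  let ?a = "3 * real N / 2 - 1"
  note pos = E_pos[OF \<open>e \<in> E\<close>] moment_pos[OF assms(1,2), of ?a]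
  have h: "0 \<le> h / e" using assms pos by simp
  then have h: "0 < 1 + h / e" by linarith
  have "?a * ln (1 + h / e) + ln (truncated_moment (M N) (v N) ?a e)
      = ln ((1 + h / e) powr ?a * truncated_moment (M N) (v N) ?a e)"
    using pos assms h by (simp add: ln_mult ln_powr)
  also have "\<dots> \<le> ln (truncated_moment (M N) (v N) ?a (e + h))"
    using pos assms h by (intro ln_mono truncated_moment_scale mult_pos_pos) auto
  finally have "(?a * ln (1 + h / e) + ln (truncated_moment (M N) (v N) ?a e)) / real N
      \<le> ln (truncated_moment (M N) (v N) ?a (e + h)) / real N"
    by (intro divide_right_mono) auto
  moreover have "?a * ln (1 + h / e) / real N = (3 / 2 - 1 / real N) * ln (1 + h / e)"
    using assms by (simp add: divide_simps)
  ultimately show ?thesis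
    by (simp add: rate_def add_divide_distrib)
qed

text \<open>The exponent is raised to \<open>3N/2\<close> at the price of moving to
  \<open>e + \<delta>\<close>, superadditivity leads to \<open>e + 4 * \<delta>\<close>, and there
  the exponent of the large system is lowered again.\<close>

lemma rate_almost_increasing:
  assumes "e \<in> E" "0 < \<delta>" "0 < \<eta>"
  shows "\<forall>\<^sub>F N in sequentially. \<forall>\<^sub>F n in sequentially. rate N e - \<eta> \<le> rate n (e + 4 * \<delta>)"
proof -
  obtain K where K: "\<forall>\<^sub>F N in sequentially. \<forall>e\<in>E. \<forall>\<^sub>F n in sequentially.
      real (n div N) * (ln (truncated_moment (M N) (v N) (3 * real N / 2) e) - K * ln (real N + 1))
        + 3 * real (n mod N) / 2 * ln \<delta>
      \<le> ln (truncated_moment (M n) (v n) (3 * real n / 2) (e + 3 * \<delta>))"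
    using superadditive[OF \<open>0 < \<delta>\<close>] by blast
  have "(\<lambda>N. (K * ln (real N + 1) - ln \<delta>) / real N) \<longlonglongrightarrow> 0" by real_asymp
  then have small: "\<forall>\<^sub>F N in sequentially. (K * ln (real N + 1) - ln \<delta>) / real N < \<eta> / 2"
    using \<open>0 < \<eta>\<close> by (intro order_tendstoD) auto
  show ?thesis using K small eventually_ge_at_top[of 1]
  proof eventually_elim
    case (elim N)
    interpret N: nonneg_variable "M N" "v N" using elim by (intro variable)
    let ?J = "\<lambda>N. truncated_moment (M N) (v N)"
    define X where "X = ln (?J N (3 * real N / 2) (e + \<delta>)) - K * ln (real N + 1)"
    \<comment> \<open>Everything that stays bounded as \<open>n\<close> grows: the incomplete block,
      the momenta of at most \<open>N\<close> leftovers, and the lowering of the exponent. It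
      depends on \<open>N\<close>, so \<open>n\<close> is sent to infinity with \<open>N\<close>
      fixed.\<close>
    define D where "D = \<bar>X\<bar> + 3 * real N / 2 * \<bar>ln \<delta>\<bar> + \<bar>ln (e + 4 * \<delta>)\<bar>"
    have E: "e + \<delta> \<in> E" "e + 4 * \<delta> \<in> E"
      using assms by (auto intro: E_up[OF \<open>e \<in> E\<close>])
    note pos = moment_pos[OF \<open>e \<in> E\<close> \<open>1 \<le> N\<close>] moment_pos[OF E(1) \<open>1 \<le> N\<close>] E_pos[OF E(2)]
    have "ln (\<delta> * ?J N (3 * real N / 2 - 1) e) \<le> ln (?J N (3 * real N / 2 - 1 + 1) (e + \<delta>))"
      using assms elim pos by (intro ln_mono N.truncated_moment_le_Suc mult_pos_pos) auto
    then have "ln \<delta> + real N * rate N e \<le> X + K * ln (real N + 1)"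
      using assms elim pos(1)[of "3 * real N / 2 - 1"] pos(2,3) by (simp add: ln_mult rate_def X_def)
    then have X: "rate N e - \<eta> / 2 \<le> X / real N"
      using elim by (simp add: field_simps)
    have "(\<lambda>n. D / real n) \<longlonglongrightarrow> 0" by real_asymp
    then have "\<forall>\<^sub>F n in sequentially. D / real n < \<eta> / 2"
      using \<open>0 < \<eta>\<close> by (intro order_tendstoD) auto
    with elim(1)[rule_format, OF E(1)] show ?case
      using eventually_ge_at_top[of 1]
    proof eventually_elim
      case (elim n)
      interpret n: nonneg_variable "M n" "v n" using elim by (intro variable)
      note posn = moment_pos[OF E(2) \<open>1 \<le> n\<close>]
      let ?Y = "ln (?J n (3 * real n / 2) (e + 4 * \<delta>))"
      have "real (n div N) * X + 3 * real (n mod N) / 2 * ln \<delta> \<le> ?Y"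
        using elim by (simp add: X_def algebra_simps)
      moreover have "?Y \<le> ln (e + 4 * \<delta>) + real n * rate n (e + 4 * \<delta>)"
      proof -
        have "ln (?J n (3 * real n / 2 - 1 + 1) (e + 4 * \<delta>)) \<le> ln ((e + 4 * \<delta>) * ?J n (3 * real n / 2 - 1) (e + 4 * \<delta>))"
          using assms elim posn pos by (intro ln_mono n.truncated_moment_Suc_le) auto
        then show ?thesis using elim posn[of "3 * real n / 2 - 1"] pos(3) by (simp add: ln_mult rate_def)
      qed
      moreover have "real n * (X / real N) - D \<le> real (n div N) * X + 3 * real (n mod N) / 2 * ln \<delta> - ln (e + 4 * \<delta>)"
      proof -
        have "real n = real (n div N) * real N + real (n mod N)"
          by (metis div_mult_mod_eq of_nat_add of_nat_mult)
        then have "real n * (X / real N) = real (n div N) * X + real (n mod N) / real N * X"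
          using \<open>1 \<le> N\<close> by (simp add: field_simps)
        moreover have "real (n mod N) / real N * X \<le> real (n mod N) / real N * \<bar>X\<bar>"
          by (intro mult_left_mono) auto
        moreover have "real (n mod N) / real N * \<bar>X\<bar> \<le> 1 * \<bar>X\<bar>"
          using \<open>1 \<le> N\<close> by (intro mult_right_mono) (auto simp: less_imp_le)
        moreover have "real (n mod N) * (3 / 2 * \<bar>ln \<delta>\<bar>) \<le> real N * (3 / 2 * \<bar>ln \<delta>\<bar>)"
          using \<open>1 \<le> N\<close> by (intro mult_right_mono) auto
        moreover have "real (n mod N) * (3 / 2 * (- ln \<delta>)) \<le> real (n mod N) * (3 / 2 * \<bar>ln \<delta>\<bar>)"
          by (intro mult_left_mono) auto
        moreover have "3 * real (n mod N) / 2 * ln \<delta> = - (real (n mod N) * (3 / 2 * (- ln \<delta>)))"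
          "3 * real N / 2 * \<bar>ln \<delta>\<bar> = real N * (3 / 2 * \<bar>ln \<delta>\<bar>)" by simp_all
        moreover have "ln (e + 4 * \<delta>) \<le> \<bar>ln (e + 4 * \<delta>)\<bar>" by (rule abs_ge_self)
        ultimately show ?thesis
          unfolding D_def by linarith
      qed
      ultimately have "real n * (X / real N) - D \<le> real n * rate n (e + 4 * \<delta>)" by linarith
      then have "X / real N - D / real n \<le> rate n (e + 4 * \<delta>)"
        using elim by (simp add: field_simps)
      with X elim show ?case by linarith
    qed
  qed
qed

text \<open>A single block size at a level slightly below \<open>e\<close> bounds all large systems
  at \<open>e\<close>: with \<open>\<delta> = d / 4\<close> the level loss
  \<open>4 * \<delta>\<close> is exactly \<open>d\<close>.\<close>

lemma rate_lower:
  assumes "e \<in> E"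
  shows "\<exists>C>0. \<forall>\<^sub>F n in sequentially. - C \<le> rate n e"
proof -
  obtain d where d: "d > 0" "e - d \<in> E" using E_down[OF assms] by blast
  have "\<forall>\<^sub>F N in sequentially. \<forall>\<^sub>F n in sequentially. rate N (e - d) - 1 \<le> rate n (e - d + 4 * (d / 4))"
    using d by (intro rate_almost_increasing) auto
  then obtain N where "\<forall>\<^sub>F n in sequentially. rate N (e - d) - 1 \<le> rate n e"
    using eventually_happens'[OF sequentially_bot] by fastforce
  then show ?thesis
    by (intro exI[of _ "\<bar>rate N (e - d) - 1\<bar> + 1"] conjI) (auto elim!: eventually_mono)
qed

lemma rate_equicontinuous:
  assumes "e \<in> E" "0 < \<eta>"
  shows "\<exists>d>0. e - d \<in> E \<and> (\<forall>\<^sub>F n in sequentially. rate n (e + d) \<le> rate n (e - d) + \<eta>)"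
proof -
  obtain C where C: "C > 0" "\<forall>\<^sub>F n in sequentially. - C \<le> rate n e" using rate_lower[OF assms(1)] by blast
  \<comment> \<open>The discarded part \<open>c powr a\<close> must be at most half the moment. The
    moment is at least \<open>exp (- C * n)\<close> and \<open>a \<ge> n\<close> for
    \<open>n \<ge> 2\<close>, so this \<open>c\<close> works, with \<open>2 * n\<close> in the
    exponent to cover the factor 2. It depends on neither \<open>n\<close> nor \<open>d\<close>,
    which leaves \<open>d\<close> free to be made small.\<close>
  define c where "c = exp (- C - 2)"
  have c: "0 < c" by (simp add: c_def)
  have "((\<lambda>d. 3 / 2 * ln (1 - 2 * d / c)) \<longlongrightarrow> 3 / 2 * ln (1 - 2 * 0 / c)) (at_right 0)"
    using c by (intro tendsto_intros) auto
  then have ev1: "\<forall>\<^sub>F d in at_right 0. - \<eta> / 2 < 3 / 2 * ln (1 - 2 * d / c)"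
    using \<open>0 < \<eta>\<close> by (intro order_tendstoD) auto
  obtain d0 where d0: "d0 > 0" "e - d0 \<in> E" using E_down[OF assms(1)] by blast
  have "\<forall>\<^sub>F d in at_right 0. d < d0 \<and> 2 * d < c \<and> 0 < d"
    using d0 c by (intro eventually_at_rightI[of 0 "min d0 (c / 2)"]) auto
  with ev1 have "\<forall>\<^sub>F d in at_right 0. (d < d0 \<and> 2 * d < c \<and> 0 < d) \<and> - \<eta> / 2 < 3 / 2 * ln (1 - 2 * d / c)"
    by eventually_elim auto
  then obtain d where d: "0 < d" "d < d0" "2 * d < c" "- \<eta> / 2 < 3 / 2 * ln (1 - 2 * d / c)"
    using eventually_happens'[OF trivial_limit_at_right_real] by blast
  have E: "e - d \<in> E" "e + d \<in> E"
    using d d0 by (auto intro: E_up[OF d0(2)] E_up[OF assms(1)])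
  have "(\<lambda>n. - ln 2 / real n) \<longlonglongrightarrow> 0" by real_asymp
  then have "\<forall>\<^sub>F n in sequentially. - \<eta> / 2 < - ln 2 / real n"
    using \<open>0 < \<eta>\<close> by (intro order_tendstoD) auto
  with C(2) have "\<forall>\<^sub>F n in sequentially. rate n (e + d) \<le> rate n (e - d) + \<eta>"
    using eventually_ge_at_top[of 2]
  proof eventually_elim
    case (elim n)
    have n1: "1 \<le> n" using elim by simp
    interpret n: nonneg_variable "M n" "v n" using n1 by (intro variable)
    let ?a = "3 * real n / 2 - 1"
    let ?J = "truncated_moment (M n) (v n) ?a"
    have a: "real n \<le> ?a" using elim by simp
    note pos = moment_pos[OF E(1) n1, of ?a] moment_pos[OF E(2) n1, of ?a] moment_pos[OF assms(1) n1, of ?a]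
    have "ln (2 * c powr ?a) \<le> ln (?J e)"
    proof -
      have "ln (2 * c powr ?a) = ln 2 - (C + 2) * ?a"
        using c by (simp add: ln_mult ln_powr c_def field_simps)
      also have "\<dots> \<le> 1 - (C + 2) * real n"
        using ln_le_minus_one[of "2::real"] a C by (intro diff_mono mult_left_mono) auto
      also have "\<dots> \<le> - C * real n"
        using elim by (simp add: algebra_simps)
      also have "\<dots> \<le> rate n e * real n"
        using elim by (intro mult_right_mono) auto
      also have "\<dots> = ln (?J e)" using elim by (simp add: rate_def)
      finally show ?thesis .
    qed
    then have "2 * c powr ?a \<le> ?J e" using pos c n1 by (subst (asm) ln_le_cancel_iff) auto
    also have "\<dots> \<le> ?J (e + d)" using d n1 by (intro n.truncated_moment_mono) auto
    finally have half: "?J (e + d) / 2 \<le> ?J (e + d) - c powr ?a" by simp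
    have "(1 - 2 * d / c) powr ?a * (?J (e + d) / 2) \<le> (1 - 2 * d / c) powr ?a * (?J (e + d) - c powr ?a)"
      using half by (intro mult_left_mono) auto
    also have "\<dots> \<le> ?J (e + d - 2 * d)"
      using d n1 by (intro n.truncated_moment_shift) auto
    finally have "ln ((1 - 2 * d / c) powr ?a * (?J (e + d) / 2)) \<le> ln (?J (e - d))"
      using d c pos n1 by (intro ln_mono) auto
    moreover have "ln ((1 - 2 * d / c) powr ?a * (?J (e + d) / 2)) = ?a * ln (1 - 2 * d / c) + ln (?J (e + d)) - ln 2"
      using d c pos n1 by (simp add: ln_mult ln_div ln_powr)
    ultimately have "rate n (e + d) \<le> rate n (e - d) - (?a * ln (1 - 2 * d / c)) / real n + ln 2 / real n"
      using n1 by (simp add: rate_def field_simps)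
    moreover have "3 / 2 * ln (1 - 2 * d / c) \<le> (?a * ln (1 - 2 * d / c)) / real n"
    proof -
      have "ln (1 - 2 * d / c) \<le> 0" using c d by simp
      then have "(3 * real n / 2) * ln (1 - 2 * d / c) \<le> ?a * ln (1 - 2 * d / c)"
        by (intro mult_right_mono_neg) auto
      then show ?thesis using n1 by (simp add: field_simps)
    qed
    ultimately show ?case using elim d by linarith
  qed
  with d E show ?thesis by blast
qed

lemma rate_convergent:
  assumes "e \<in> E"
  shows "convergent (\<lambda>n. rate n e)"
proof -
  obtain C where C: "C > 0" "\<forall>\<^sub>F n in sequentially. - C \<le> rate n e" using rate_lower[OF assms(1)] by blast
  show ?thesis
  proof (rule convergent_if_almost_increasing)
    show "\<forall>\<^sub>F n in sequentially. \<bar>rate n e\<bar> \<le> max C (3 / 2 * \<bar>ln e\<bar>)"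
      using C(2) eventually_ge_at_top[of 1]
      by eventually_elim (use rate_upper[OF assms] C(1) in fastforce)
    \<comment> \<open>With \<open>\<delta> = d / 2\<close> the level loss
      \<open>4 * \<delta>\<close> is the width of the window from \<open>e - d\<close> to
      \<open>e + d\<close>. Equicontinuity is used on both sides: once for \<open>N\<close> to
      descend to \<open>e - d\<close>, once for \<open>n\<close> to return from
      \<open>e + d\<close>.\<close>
    fix \<eta> :: real assume \<eta>: "\<eta> > 0"
    obtain d where d: "d > 0" "e - d \<in> E" "\<forall>\<^sub>F n in sequentially. rate n (e + d) \<le> rate n (e - d) + \<eta> / 3"
      using rate_equicontinuous[of e "\<eta> / 3"] assms \<eta> by auto
    have "\<forall>\<^sub>F N in sequentially. \<forall>\<^sub>F n in sequentially. rate N (e - d) - \<eta> / 3 \<le> rate n (e - d + 4 * (d / 2))"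
      using d \<eta> by (intro rate_almost_increasing) auto
    with d(3) show "\<forall>\<^sub>F N in sequentially. \<forall>\<^sub>F n in sequentially. rate N e - \<eta> \<le> rate n e"
      using eventually_ge_at_top[of 1]
    proof eventually_elim
      case (elim N)
      have N: "rate N e \<le> rate N (e + d)"
        using d elim assms by (intro rate_mono) auto
      show ?case using elim(2) d(3) eventually_ge_at_top[of 1]
      proof eventually_elim
        case (elim n)
        have "rate n (e - d) \<le> rate n e"
          using d elim assms by (intro rate_mono) auto
        moreover have "rate n (e - d + 4 * (d / 2)) = rate n (e + d)" by (simp add: add.commute)
        ultimately show ?case
          using N elim \<open>rate N (e + d) \<le> rate N (e - d) + \<eta> / 3\<close> by linarith
      qed
    qed
  qed
qed

text \<open>The gap in \<open>rate_scale\<close> tends to \<open>3/2 * ln (e' / e)\<close>, which is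
  positive, so strictness survives the limit. For continuity, monotonicity squeezes all values on a
  window between its endpoints, and equicontinuity bounds their difference.\<close>

theorem rate_limit:
  "\<exists>s. (\<forall>e\<in>E. (\<lambda>n. rate n e) \<longlonglongrightarrow> s e) \<and> continuous_on E s \<and> strict_mono_on E s"
proof -
  define s where "s e = lim (\<lambda>n. rate n e)" for e
  have lim: "(\<lambda>n. rate n e) \<longlonglongrightarrow> s e" if "e \<in> E" for e
    using rate_convergent[OF that] unfolding s_def by (simp add: convergent_LIMSEQ_iff)
  have strict: "s e < s e'" if "e \<in> E" "e < e'" for e e'
  proof -
    have e': "e' \<in> E" using that by (auto intro: E_up)
    have "(\<lambda>n. rate n e + (3 / 2 - 1 / real n) * ln (1 + (e' - e) / e)) \<longlonglongrightarrow> s e + (3 / 2 - 0) * ln (1 + (e' - e) / e)"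
      by (intro tendsto_intros lim that lim_1_over_n)
    then have "(\<lambda>n. rate n e + (3 / 2 - 1 / real n) * ln (1 + (e' - e) / e)) \<longlonglongrightarrow> s e + 3 / 2 * ln (1 + (e' - e) / e)"
      by simp
    moreover have "\<forall>\<^sub>F n in sequentially. rate n e + (3 / 2 - 1 / real n) * ln (1 + (e' - e) / e) \<le> rate n e'"
      using eventually_ge_at_top[of 1]
      by eventually_elim (use rate_scale[of e _ "e' - e"] that in auto)
    ultimately have "s e + 3 / 2 * ln (1 + (e' - e) / e) \<le> s e'"
      using lim[OF e'] by (intro tendsto_le[OF sequentially_bot]) auto
    moreover have "0 < ln (1 + (e' - e) / e)"
      using that E_pos[OF that(1)] by (intro ln_gt_zero) auto
    ultimately show ?thesis by linarith
  qed
  have mono: "s e \<le> s e'" if "e \<in> E" "e \<le> e'" for e e'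
    using strict[of e e'] that by (cases "e = e'") auto
  have "continuous_on E s"
    unfolding continuous_on_iff
  proof (intro ballI allI impI)
    fix e \<eta> :: real assume e: "e \<in> E" and \<eta>: "0 < \<eta>"
    obtain d where d: "d > 0" "e - d \<in> E" "\<forall>\<^sub>F n in sequentially. rate n (e + d) \<le> rate n (e - d) + \<eta> / 2"
      using rate_equicontinuous[of e "\<eta> / 2"] e \<eta> by auto
    have ed: "e + d \<in> E" using d by (intro E_up[OF e]) auto
    have "s (e + d) \<le> s (e - d) + \<eta> / 2"
      using d(3) by (intro tendsto_le[OF sequentially_bot tendsto_add[OF lim[OF d(2)] tendsto_const] lim[OF ed]])
    show "\<exists>d>0. \<forall>x'\<in>E. dist x' e < d \<longrightarrow> dist (s x') (s e) < \<eta>"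
    proof (intro exI[of _ d] conjI ballI impI d)
      fix x' assume "x' \<in> E" "dist x' e < d"
      then have "s (e - d) \<le> s x'" "s x' \<le> s (e + d)"
        using d by (auto intro!: mono simp: dist_real_def)
      moreover have "s (e - d) \<le> s e" "s e \<le> s (e + d)" using d e by (auto intro!: mono)
      ultimately show "dist (s x') (s e) < \<eta>"
        using \<open>s (e + d) \<le> s (e - d) + \<eta> / 2\<close> \<eta> by (auto simp: dist_real_def)
    qed
  qed
  moreover have "strict_mono_on E s" using strict by (auto simp: strict_mono_on_def)
  ultimately show ?thesis using lim by blast
qed

end

section \<open>Superadditivity of mean-field energies\<close>

text \<open>The full double sum is what becomes a quadratic form in the occupation numbers. The
  diagonal has only \<open>N\<close> terms and is negligible against
  \<open>N\<^sup>2\<close>.\<close>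

lemma sum_sum_symmetric:
  fixes f :: "nat \<Rightarrow> nat \<Rightarrow> real"
  assumes "\<And>i j. f i j = f j i"
  shows "(\<Sum>i\<in>{1..N}. \<Sum>j\<in>{1..N}. f i j) = 2 * (\<Sum>i\<in>{1..N}. \<Sum>j\<in>{i<..N}. f i j) + (\<Sum>i\<in>{1..N}. f i i)"
proof (induction N)
  case (Suc N)
  have "(\<Sum>i\<in>{1..N}. \<Sum>j\<in>{i<..Suc N}. f i j) = (\<Sum>i\<in>{1..N}. (\<Sum>j\<in>{i<..N}. f i j) + f i (Suc N))"
  proof (rule sum.cong)
    fix i assume "i \<in> {1..N}"
    then have "{i<..Suc N} = insert (Suc N) {i<..N}" by auto
    then show "(\<Sum>j\<in>{i<..Suc N}. f i j) = (\<Sum>j\<in>{i<..N}. f i j) + f i (Suc N)" by simp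
  qed simp
  moreover have "(\<Sum>j\<in>{1..N}. f (Suc N) j) = (\<Sum>i\<in>{1..N}. f i (Suc N))"
    by (rule sum.cong) (auto intro: assms)
  ultimately show ?case
    using Suc by (simp add: sum.distrib algebra_simps)
qed simp

locale mean_field =
  fixes P :: "'a measure" and u :: "'a \<Rightarrow> 'a \<Rightarrow> real" and B :: real
  assumes prob_space_P: "prob_space P"
    and measurable_u[measurable]: "(\<lambda>(x, y). u x y) \<in> borel_measurable (P \<Otimes>\<^sub>M P)"
    and u_sym: "u x y = u y x"
    and u_nonneg: "0 \<le> u x y"
    and u_le: "u x y \<le> B"
begin

definition configurations :: "nat set \<Rightarrow> (nat \<Rightarrow> 'a) measure" where
  "configurations I = (\<Pi>\<^sub>M i\<in>I. P)"

definition energy :: "nat \<Rightarrow> (nat \<Rightarrow> 'a) \<Rightarrow> real" where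
  "energy N q = (\<Sum>i\<in>{1..N}. \<Sum>j\<in>{i<..N}. u (q i) (q j)) / (real N)\<^sup>2"

lemma prob_space_configurations: "prob_space (configurations I)"
  unfolding configurations_def by (intro prob_space_PiM prob_space_P)

lemma measurable_component[measurable]: "i \<in> I \<Longrightarrow> (\<lambda>q. q i) \<in> configurations I \<rightarrow>\<^sub>M P"
  unfolding configurations_def by simp

lemma measurable_pair_energy:
  assumes "i \<in> I" "j \<in> I"
  shows "(\<lambda>q. u (q i) (q j)) \<in> borel_measurable (configurations I)"
proof -
  have "(\<lambda>q. (q i, q j)) \<in> configurations I \<rightarrow>\<^sub>M P \<Otimes>\<^sub>M P"
    using assms by (intro measurable_Pair measurable_component)
  from measurable_compose[OF this measurable_u] show ?thesis by simp
qed

lemma nonneg_variable_energy: "nonneg_variable (configurations {1..N}) (energy N)"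
proof -
  interpret prob_space "configurations {1..N}" by (rule prob_space_configurations)
  show ?thesis
  proof
    show "energy N \<in> borel_measurable (configurations {1..N})"
      unfolding energy_def
      by (intro borel_measurable_divide borel_measurable_sum measurable_pair_energy borel_measurable_const) auto
  qed (auto simp: energy_def intro!: divide_nonneg_nonneg sum_nonneg u_nonneg)
qed

end

section \<open>Rounding to finitely many cells and occupation numbers\<close>

locale discretized_mean_field = mean_field +
  fixes \<delta> :: real and K :: nat and \<phi> :: "'a \<Rightarrow> nat" and w :: "nat \<Rightarrow> nat \<Rightarrow> real"
  assumes \<delta>: "0 < \<delta>"
    and measurable_\<phi>[measurable]: "\<phi> \<in> P \<rightarrow>\<^sub>M count_space UNIV"
    and \<phi>_less: "\<phi> x < K"
    and w_nonneg: "0 \<le> w a b"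
    and w_le: "w a b \<le> B"
    and step: "\<bar>u x y - w (\<phi> x) (\<phi> y)\<bar> \<le> \<delta>"
begin

definition occ :: "nat set \<Rightarrow> (nat \<Rightarrow> 'a) \<Rightarrow> nat \<Rightarrow> nat" where
  "occ I q a = (\<Sum>i\<in>I. of_bool (\<phi> (q i) = a))"

text \<open>Lower bounds instead of equalities leave surplus particles unrestricted, so that
  leftovers can be added to a pattern at no cost in probability.\<close>

definition occ_ge :: "nat set \<Rightarrow> (nat \<Rightarrow> nat) \<Rightarrow> (nat \<Rightarrow> 'a) set" where
  "occ_ge I n = {q \<in> space (configurations I). \<forall>a<K. n a \<le> occ I q a}"

text \<open>At \<open>n = occ I q\<close> with \<open>I\<close> finite, this is the rounded
  interaction summed over all ordered pairs of particles, self-pairs included.\<close>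

definition quad :: "(nat \<Rightarrow> nat) \<Rightarrow> real" where
  "quad n = (\<Sum>a<K. \<Sum>b<K. real (n a) * real (n b) * w a b)"

lemma sets_occ_ge[measurable]: "occ_ge I n \<in> sets (configurations I)"
proof -
  have "(\<lambda>q. \<Sum>i\<in>I. of_bool (\<phi> (q i) = a) :: real) \<in> borel_measurable (configurations I)" for a
    by measurable
  then have "{q \<in> space (configurations I). \<forall>a<K. real (n a) \<le> (\<Sum>i\<in>I. of_bool (\<phi> (q i) = a))} \<in> sets (configurations I)"
    by measurable
  moreover have "(\<Sum>i\<in>I. of_bool (\<phi> (q i) = a)) = real (occ I q a)" for q a
    by (simp add: occ_def)
  ultimately show ?thesis unfolding occ_ge_def by (simp only: of_nat_le_iff)
qed

lemma sum_occ:
  assumes "finite I"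
  shows "(\<Sum>a<K. real (occ I q a) * f a) = (\<Sum>i\<in>I. f (\<phi> (q i)))"
proof -
  have "(\<Sum>a<K. real (occ I q a) * f a) = (\<Sum>a<K. \<Sum>i\<in>I. of_bool (\<phi> (q i) = a) * f a)"
    by (simp add: occ_def sum_distrib_right)
  also have "\<dots> = (\<Sum>i\<in>I. \<Sum>a<K. of_bool (\<phi> (q i) = a) * f a)"
    by (rule sum.swap)
  also have "\<dots> = (\<Sum>i\<in>I. \<Sum>a<K. if \<phi> (q i) = a then f a else 0)"
    by (intro sum.cong) auto
  also have "\<dots> = (\<Sum>i\<in>I. f (\<phi> (q i)))"
    using \<phi>_less by (subst sum.delta') auto
  finally show ?thesis .
qed

lemma sum_occ_eq_card: "finite I \<Longrightarrow> (\<Sum>a<K. occ I q a) = card I"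
  using sum_occ[of I q "\<lambda>_. 1"] by (simp flip: of_nat_sum)

lemma quad_occ:
  assumes "finite I"
  shows "quad (occ I q) = (\<Sum>i\<in>I. \<Sum>j\<in>I. w (\<phi> (q i)) (\<phi> (q j)))"
proof -
  have "quad (occ I q) = (\<Sum>a<K. real (occ I q a) * (\<Sum>b<K. real (occ I q b) * w a b))"
    by (simp add: quad_def sum_distrib_left mult.assoc)
  then show ?thesis by (simp add: sum_occ assms)
qed

lemma quad_occ_approx:
  "\<bar>(\<Sum>i\<in>{1..N}. \<Sum>j\<in>{1..N}. u (q i) (q j)) - quad (occ {1..N} q)\<bar> \<le> \<delta> * (real N)\<^sup>2"
proof -
  have "\<bar>\<Sum>i\<in>{1..N}. \<Sum>j\<in>{1..N}. u (q i) (q j) - w (\<phi> (q i)) (\<phi> (q j))\<bar>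
      \<le> (\<Sum>i\<in>{1..N}. \<Sum>j\<in>{1..N}. \<delta>)"
    by (intro order.trans[OF sum_abs] sum_mono step)
  then show ?thesis
    by (simp add: quad_occ sum_subtractf power2_eq_square mult_ac)
qed

lemma energy_upper:
  assumes "1 \<le> N"
  shows "energy N q \<le> quad (occ {1..N} q) / (2 * (real N)\<^sup>2) + \<delta> / 2"
proof -
  have "0 \<le> (\<Sum>i\<in>{1..N}. u (q i) (q i))" by (intro sum_nonneg u_nonneg)
  then have "2 * (\<Sum>i\<in>{1..N}. \<Sum>j\<in>{i<..N}. u (q i) (q j)) \<le> quad (occ {1..N} q) + \<delta> * (real N)\<^sup>2"
    using quad_occ_approx[of q N] sum_sum_symmetric[of "\<lambda>i j. u (q i) (q j)" N, OF u_sym] by linarith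
  then show ?thesis
    using assms by (simp add: energy_def field_simps)
qed

text \<open>Half of the loss \<open>\<delta>\<close> is rounding. The other half is the diagonal:
  its sum is at most \<open>N * B\<close>, which the condition on \<open>N\<close> bounds by
  \<open>\<delta> * N\<^sup>2\<close>.\<close>

lemma energy_lower:
  assumes "1 \<le> N" "B \<le> \<delta> * real N"
  shows "quad (occ {1..N} q) / (2 * (real N)\<^sup>2) - \<delta> \<le> energy N q"
proof -
  have "(\<Sum>i\<in>{1..N}. u (q i) (q i)) \<le> (\<Sum>i\<in>{1..N}. \<delta> * real N)"
    by (intro sum_mono order.trans[OF u_le assms(2)])
  also have "\<dots> = \<delta> * (real N)\<^sup>2" by (simp add: power2_eq_square)
  finally have "quad (occ {1..N} q) - 2 * \<delta> * (real N)\<^sup>2 \<le> 2 * (\<Sum>i\<in>{1..N}. \<Sum>j\<in>{i<..N}. u (q i) (q j))"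
    using quad_occ_approx[of q N] sum_sum_symmetric[of "\<lambda>i j. u (q i) (q j)" N, OF u_sym]
    by linarith
  then have "(quad (occ {1..N} q) - 2 * \<delta> * (real N)\<^sup>2) / (2 * (real N)\<^sup>2)
      \<le> 2 * (\<Sum>i\<in>{1..N}. \<Sum>j\<in>{i<..N}. u (q i) (q j)) / (2 * (real N)\<^sup>2)"
    by (intro divide_right_mono) auto
  then show ?thesis
    using assms by (simp add: energy_def diff_divide_distrib)
qed

lemma measure_occ_ge_reindex:
  assumes "finite I" "finite J" "card I = card J"
  shows "measure (configurations I) (occ_ge I n) = measure (configurations J) (occ_ge J n)"
proof -
  obtain f where f: "bij_betw f I J"
    using assms finite_same_card_bij by blast
  let ?t = "\<lambda>q. \<lambda>i\<in>I. q (f i)"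
  have t[measurable]: "?t \<in> configurations J \<rightarrow>\<^sub>M configurations I"
    unfolding configurations_def
    using f by (intro measurable_restrict measurable_component_singleton) (auto simp: bij_betw_def)
  have "distr (configurations J) (configurations I) ?t = configurations I"
    unfolding configurations_def
    using f by (intro distr_PiM_reindex prob_space_P) (auto simp: bij_betw_def)
  then have "measure (configurations I) (occ_ge I n)
      = measure (distr (configurations J) (configurations I) ?t) (occ_ge I n)" by simp
  also have "\<dots> = measure (configurations J) (?t -` occ_ge I n \<inter> space (configurations J))"
    by (rule measure_distr) measurable
  also have "occ I (?t q) a = occ J q a" for q a
    unfolding occ_def using f by (simp add: sum.reindex_bij_betw[of f I J "\<lambda>j. of_bool (\<phi> (q j) = a)"])
  then have "?t -` occ_ge I n \<inter> space (configurations J) = occ_ge J n"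
    using measurable_space[OF t] by (auto simp: occ_ge_def)
  finally show ?thesis .
qed

text \<open>Particles with disjoint labels are independent and their occupation numbers add, so the
  product of the two events is contained in the event for the merged configuration.\<close>

lemma measure_occ_ge_superadditive:
  assumes "finite I" "finite J" "I \<inter> J = {}"
  shows "measure (configurations I) (occ_ge I n) * measure (configurations J) (occ_ge J m)
    \<le> measure (configurations (I \<union> J)) (occ_ge (I \<union> J) (\<lambda>a. n a + m a))"
proof -
  interpret P: prob_space P by (rule prob_space_P)
  interpret PS: product_sigma_finite "\<lambda>_::nat. P" by unfold_locales
  interpret I: prob_space "configurations I" by (rule prob_space_configurations)
  interpret J: prob_space "configurations J" by (rule prob_space_configurations)
  interpret IJ: pair_prob_space "configurations I" "configurations J" ..
  have t[measurable]: "merge I J \<in> configurations I \<Otimes>\<^sub>M configurations J \<rightarrow>\<^sub>M configurations (I \<union> J)"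
    unfolding configurations_def by measurable
  have d: "distr (configurations I \<Otimes>\<^sub>M configurations J) (configurations (I \<union> J)) (merge I J) = configurations (I \<union> J)"
    unfolding configurations_def using assms by (intro PS.distr_merge)
  have occ: "occ (I \<union> J) (merge I J (q, q')) a = occ I q a + occ J q' a" for q q' a
  proof -
    have "occ (I \<union> J) (merge I J (q, q')) a
        = (\<Sum>i\<in>I. of_bool (\<phi> (merge I J (q, q') i) = a)) + (\<Sum>i\<in>J. of_bool (\<phi> (merge I J (q, q') i) = a))"
      unfolding occ_def using assms by (intro sum.union_disjoint)
    also have "(\<Sum>i\<in>I. of_bool (\<phi> (merge I J (q, q') i) = a)) = occ I q a"
      unfolding occ_def by (rule sum.cong) (auto simp: merge_def)
    also have "(\<Sum>i\<in>J. of_bool (\<phi> (merge I J (q, q') i) = a)) = occ J q' a"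
      unfolding occ_def using assms by (intro sum.cong) (auto simp: merge_def)
    finally show ?thesis .
  qed
  have "measure (configurations I) (occ_ge I n) * measure (configurations J) (occ_ge J m)
      = measure (configurations I \<Otimes>\<^sub>M configurations J) (occ_ge I n \<times> occ_ge J m)"
    by (simp add: measure_def J.emeasure_pair_measure_Times enn2real_mult)
  also have "\<dots> \<le> measure (configurations I \<Otimes>\<^sub>M configurations J)
      (merge I J -` occ_ge (I \<union> J) (\<lambda>a. n a + m a) \<inter> space (configurations I \<Otimes>\<^sub>M configurations J))"
  proof (rule IJ.finite_measure_mono)
    show "occ_ge I n \<times> occ_ge J m \<subseteq> merge I J -` occ_ge (I \<union> J) (\<lambda>a. n a + m a) \<inter> space (configurations I \<Otimes>\<^sub>M configurations J)"
    proof (clarify, intro IntI vimageI2)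
      fix q q' assume q: "q \<in> occ_ge I n" "q' \<in> occ_ge J m"
      then show sp: "(q, q') \<in> space (configurations I \<Otimes>\<^sub>M configurations J)"
        by (auto simp: occ_ge_def space_pair_measure)
      show "merge I J (q, q') \<in> occ_ge (I \<union> J) (\<lambda>a. n a + m a)"
        using measurable_space[OF t sp] q by (auto simp: occ_ge_def occ intro: add_mono)
    qed
  qed measurable
  also have "\<dots> = measure (distr (configurations I \<Otimes>\<^sub>M configurations J) (configurations (I \<union> J)) (merge I J))
      (occ_ge (I \<union> J) (\<lambda>a. n a + m a))"
    by (rule measure_distr[symmetric]) measurable
  finally show ?thesis by (simp only: d)
qed

text \<open>The induction starts from \<open>r\<close> unconstrained particles, whose event has
  probability one, and appends one block of \<open>N\<close> fresh labels at a time behind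
  them.\<close>

lemma measure_occ_ge_power:
  "measure (configurations {1..N}) (occ_ge {1..N} n) ^ k
    \<le> measure (configurations {1..k * N + r}) (occ_ge {1..k * N + r} (\<lambda>a. k * n a))"
proof (induction k)
  case 0
  interpret prob_space "configurations {1..r}" by (rule prob_space_configurations)
  show ?case using prob_space by (simp add: occ_ge_def)
next
  case (Suc k)
  let ?Q = "\<lambda>I n. measure (configurations I) (occ_ge I n)"
  let ?J = "{k * N + r + 1..Suc k * N + r}"
  have *: "{1..Suc k * N + r} = {1..k * N + r} \<union> ?J" by auto
  have J: "?Q {1..N} n = ?Q ?J n"
    by (rule measure_occ_ge_reindex) auto
  have "?Q {1..N} n ^ Suc k \<le> ?Q {1..k * N + r} (\<lambda>a. k * n a) * ?Q {1..N} n"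
    using Suc by (auto simp: mult.commute intro: mult_left_mono)
  also have "\<dots> = ?Q {1..k * N + r} (\<lambda>a. k * n a) * ?Q ?J n"
    by (simp only: J)
  also have "?Q {1..k * N + r} (\<lambda>a. k * n a) * ?Q ?J n
      \<le> ?Q {1..Suc k * N + r} (\<lambda>a. k * n a + n a)"
    unfolding * by (rule measure_occ_ge_superadditive) auto
  finally show ?case by (simp add: add.commute)
qed

text \<open>Every product \<open>c a * c b\<close> exceeds its counterpart in the \<open>k\<close>
  copies by a nonnegative amount, on which \<open>w\<close> may be replaced by \<open>B\<close>.
  These amounts total the number of ordered pairs outside the copies.\<close>

lemma quad_le_of_occ_ge:
  assumes "\<And>a. a < K \<Longrightarrow> k * n a \<le> c a" "(\<Sum>a<K. n a) = N" "(\<Sum>a<K. c a) = m"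
  shows "quad c \<le> (real k)\<^sup>2 * quad n + B * ((real m)\<^sup>2 - (real k * real N)\<^sup>2)"
proof -
  have s2: "(\<Sum>a<K. \<Sum>b<K. real (x a) * real (x b)) = (real (\<Sum>a<K. x a))\<^sup>2" for x :: "nat \<Rightarrow> nat"
    by (simp add: power2_eq_square sum_product)
  have "quad c - (real k)\<^sup>2 * quad n = (\<Sum>a<K. \<Sum>b<K. (real (c a) * real (c b) - (real k)\<^sup>2 * (real (n a) * real (n b))) * w a b)"
    by (simp add: quad_def sum_distrib_left sum_subtractf algebra_simps)
  also have "\<dots> \<le> (\<Sum>a<K. \<Sum>b<K. (real (c a) * real (c b) - (real k)\<^sup>2 * (real (n a) * real (n b))) * B)"
  proof (intro sum_mono mult_left_mono w_le)
    fix a b assume "a \<in> {..<K}" "b \<in> {..<K}"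
    then have "(k * n a) * (k * n b) \<le> c a * c b"
      by (intro mult_mono assms) auto
    then have "real ((k * n a) * (k * n b)) \<le> real (c a * c b)" by (rule of_nat_mono)
    then show "0 \<le> real (c a) * real (c b) - (real k)\<^sup>2 * (real (n a) * real (n b))"
      by (simp add: power2_eq_square algebra_simps)
  qed
  also have "\<dots> = B * ((\<Sum>a<K. \<Sum>b<K. real (c a) * real (c b)) - (real k)\<^sup>2 * (\<Sum>a<K. \<Sum>b<K. real (n a) * real (n b)))"
    by (simp add: sum_distrib_left sum_distrib_right sum_subtractf algebra_simps)
  also have "\<dots> = B * ((real m)\<^sup>2 - (real k * real N)\<^sup>2)"
    using s2[of c] s2[of n] by (simp add: assms(2,3) power_mult_distrib)
  finally show ?thesis by simp
qed

lemma quad_nonneg: "0 \<le> quad n"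
  unfolding quad_def by (intro sum_nonneg mult_nonneg_nonneg w_nonneg) auto

text \<open>The copies have the cell fractions of one block, so division by the squared particle
  number returns the block energy. At most \<open>2 * N * m\<close> ordered pairs involve a leftover
  particle, and the second condition on \<open>m\<close> makes them cost
  \<open>\<delta> / 2\<close>; rounding costs the other half.\<close>

lemma energy_le_of_occ_ge:
  assumes N: "1 \<le> N" and n: "(\<Sum>a<K. n a) = N"
    and m: "N \<le> m" "2 * real N * B \<le> \<delta> * real m"
    and q: "q \<in> occ_ge {1..m} (\<lambda>a. m div N * n a)"
  shows "energy m q \<le> quad n / (2 * (real N)\<^sup>2) + \<delta>"
proof -
  define k r where "k = real (m div N)" and "r = real (m mod N)"
  have mr: "real m = k * real N + r" and r: "0 \<le> r" "r \<le> real N" and k: "0 \<le> k"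
    using N by (auto simp: k_def r_def less_imp_le simp flip: of_nat_mult of_nat_add)
  have B: "0 \<le> B" using w_nonneg[of 0 0] w_le[of 0 0] by simp
  have "(real m)\<^sup>2 - (k * real N)\<^sup>2 = r * (real m + k * real N)"
    by (simp add: mr power2_eq_square algebra_simps)
  also have "\<dots> \<le> real N * (real m + real m)"
    using r k by (intro mult_mono add_mono) (auto simp: mr)
  finally have *: "B * ((real m)\<^sup>2 - (k * real N)\<^sup>2) \<le> B * (real N * (2 * real m))"
    using B by (intro mult_left_mono) auto
  have "real m * (2 * real N * B) \<le> real m * (\<delta> * real m)"
    using m by (intro mult_left_mono) auto
  with * have "B * ((real m)\<^sup>2 - (k * real N)\<^sup>2) \<le> \<delta> * (real m)\<^sup>2"
    by (simp add: power2_eq_square mult_ac)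
  moreover have "quad (occ {1..m} q) \<le> k\<^sup>2 * quad n + B * ((real m)\<^sup>2 - (k * real N)\<^sup>2)"
    using q n unfolding k_def by (intro quad_le_of_occ_ge) (auto simp: occ_ge_def sum_occ_eq_card)
  ultimately have "quad (occ {1..m} q) / (2 * (real m)\<^sup>2) \<le> (k\<^sup>2 * quad n + \<delta> * (real m)\<^sup>2) / (2 * (real m)\<^sup>2)"
    by (intro divide_right_mono) auto
  also have "\<dots> = k\<^sup>2 * quad n / (2 * (real m)\<^sup>2) + \<delta> / 2"
    using N m by (simp add: add_divide_distrib)
  also have "k\<^sup>2 * quad n / (2 * (real m)\<^sup>2) \<le> quad n / (2 * (real N)\<^sup>2)"
  proof -
    have "(k * real N)\<^sup>2 \<le> (real m)\<^sup>2" using k r by (intro power_mono) (auto simp: mr)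
    then have "(k * real N)\<^sup>2 * quad n \<le> (real m)\<^sup>2 * quad n" by (intro mult_right_mono quad_nonneg)
    then show ?thesis using N m by (simp add: field_simps)
  qed
  finally have "quad (occ {1..m} q) / (2 * (real m)\<^sup>2) \<le> quad n / (2 * (real N)\<^sup>2) + \<delta> / 2" by simp
  then show ?thesis using energy_upper[of m q] N m by simp
qed

lemma card_bounded_functions: "card ({..<K} \<rightarrow>\<^sub>E {..N}) = (N + 1) ^ K"
  by (simp add: card_funcsetE)

text \<open>A pigeonhole argument: the integrand is dominated by a sum over at most
  \<open>(N + 1) ^ K\<close> patterns, so they cannot all fall below the average share of the
  moment.\<close>

lemma dominant_occupation:
  assumes N: "1 \<le> N" "B \<le> \<delta> * real N" and a: "0 \<le> a"
  shows "\<exists>n. (\<Sum>a<K. n a) = N \<and>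
    truncated_moment (configurations {1..N}) (energy N) a e / (real N + 1) ^ K
    \<le> max 0 (e + \<delta> - quad n / (2 * (real N)\<^sup>2)) powr a * measure (configurations {1..N}) (occ_ge {1..N} n)"
proof (rule ccontr)
  let ?J = "truncated_moment (configurations {1..N}) (energy N) a e"
  define g where "g n = max 0 (e + \<delta> - quad n / (2 * (real N)\<^sup>2)) powr a" for n
  define T where "T = {n \<in> {..<K} \<rightarrow>\<^sub>E {..N}. (\<Sum>a<K. n a) = N}"
  assume "\<not> ?thesis"
  then have "\<forall>n. (\<Sum>a<K. n a) = N \<longrightarrow>
      \<not> ?J / (real N + 1) ^ K \<le> g n * measure (configurations {1..N}) (occ_ge {1..N} n)"
    unfolding g_def by blast
  then have less: "g n * measure (configurations {1..N}) (occ_ge {1..N} n) < ?J / (real N + 1) ^ K"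
    if "n \<in> T" for n
    using that by (simp add: T_def not_le)
  interpret nonneg_variable "configurations {1..N}" "energy N" by (rule nonneg_variable_energy)
  have T: "finite T" 
    by (rule finite_subset[of _ "{..<K} \<rightarrow>\<^sub>E {..N}"]) (auto simp: T_def intro: finite_PiE)
  have cardT: "card T \<le> (N + 1) ^ K"
    unfolding T_def card_bounded_functions[symmetric] by (intro card_mono finite_PiE) auto
  have pw: "max 0 (e - energy N q) powr a \<le> (\<Sum>n\<in>T. g n * indicator (occ_ge {1..N} n) q)"
    and restrict: "restrict (occ {1..N} q) {..<K} \<in> T"
    if q: "q \<in> space (configurations {1..N})" for q
  proof -
    define n where "n = restrict (occ {1..N} q) {..<K}"
    have "occ {1..N} q b \<le> N" for b
      unfolding occ_def by (rule order.trans[OF sum_bounded_above[where K = 1]]) auto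
    then have n: "n \<in> T"
      by (auto simp: n_def T_def sum_occ_eq_card)
    then show "restrict (occ {1..N} q) {..<K} \<in> T" by (simp add: n_def)
    \<comment> \<open>Both \<open>quad\<close> and \<open>occ_ge\<close> look only at labels below
      \<open>K\<close>, so cutting the pattern off there, which makes \<open>T\<close> finite,
      changes neither.\<close>
    have "quad n = quad (occ {1..N} q)" by (simp add: quad_def n_def)
    then have "max 0 (e - energy N q) powr a \<le> g n"
      using energy_lower[OF N, of q] a unfolding g_def by (intro powr_mono2) auto
    also have "\<dots> = g n * indicator (occ_ge {1..N} n) q"
      using q by (simp add: occ_ge_def n_def)
    also have "\<dots> \<le> (\<Sum>n\<in>T. g n * indicator (occ_ge {1..N} n) q)"
      using n T by (intro member_le_sum) (auto simp: g_def)
    finally show "max 0 (e - energy N q) powr a \<le> (\<Sum>n\<in>T. g n * indicator (occ_ge {1..N} n) q)" .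
  qed
  \<comment> \<open>A strict inequality between sums over \<open>T\<close> requires a summand; a
    probability space has a point, and its pattern is one.\<close>
  have "T \<noteq> {}" using not_empty restrict by blast
  have "?J \<le> (LINT q|configurations {1..N}. (\<Sum>n\<in>T. g n * indicator (occ_ge {1..N} n) q))"
    unfolding truncated_moment_def using a pw emeasure_finite
    by (intro integral_mono integrable_truncated_power Bochner_Integration.integrable_sum
        integrable_mult_right integrable_real_indicator) (auto simp: less_top[symmetric])
  also have "\<dots> = (\<Sum>n\<in>T. g n * measure (configurations {1..N}) (occ_ge {1..N} n))"
    using emeasure_finite by (subst Bochner_Integration.integral_sum)
      (auto intro!: integrable_mult_right integrable_real_indicator simp: less_top[symmetric])
  also have "\<dots> < (\<Sum>n\<in>T. ?J / (real N + 1) ^ K)"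
    using T \<open>T \<noteq> {}\<close> less by (intro sum_strict_mono) auto
  also have "\<dots> = real (card T) * (?J / (real N + 1) ^ K)" by simp
  also have "\<dots> \<le> real ((N + 1) ^ K) * (?J / (real N + 1) ^ K)"
    using cardT truncated_moment_nonneg
    by (intro mult_right_mono divide_nonneg_nonneg of_nat_mono) auto
  also have "\<dots> = ?J" by (simp add: add.commute)
  finally show False by simp
qed

text \<open>Each \<delta> has its own task. Rounding in the block replaces \<open>e\<close> by
  \<open>e + \<delta>\<close>, which leaves the excess \<open>t\<close>. Rounding and leftovers in
  the large system cost the second. The third raises the excess to \<open>t + \<delta>\<close>,
  hence to at least \<open>\<delta>\<close> for the factor belonging to the \<open>m mod N\<close>
  leftovers. The exponents of blocks and leftovers add up to exactly \<open>3m/2\<close>.\<close>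

lemma truncated_moment_superadditive:
  assumes N: "1 \<le> N" "B \<le> \<delta> * real N"
    and m: "N \<le> m" "2 * real N * B \<le> \<delta> * real m"
    and pos: "0 < truncated_moment (configurations {1..N}) (energy N) (3 * real N / 2) e"
  shows "(truncated_moment (configurations {1..N}) (energy N) (3 * real N / 2) e / (real N + 1) ^ K) ^ (m div N)
      * \<delta> powr (3 * real (m mod N) / 2)
    \<le> truncated_moment (configurations {1..m}) (energy m) (3 * real m / 2) (e + 3 * \<delta>)"
proof -
  let ?J = "truncated_moment (configurations {1..N}) (energy N) (3 * real N / 2) e"
  obtain n where n: "(\<Sum>a<K. n a) = N" and
    J: "?J / (real N + 1) ^ K \<le> max 0 (e + \<delta> - quad n / (2 * (real N)\<^sup>2)) powr (3 * real N / 2)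
        * measure (configurations {1..N}) (occ_ge {1..N} n)"
    using dominant_occupation[OF N, of "3 * real N / 2" e] by auto
  define t where "t = e + \<delta> - quad n / (2 * (real N)\<^sup>2)"
  define Q where "Q = measure (configurations {1..N}) (occ_ge {1..N} n)"
  have "0 < ?J / (real N + 1) ^ K" using pos by simp
  with J have "max 0 t powr (3 * real N / 2) \<noteq> 0"
    by (auto simp: t_def)
  then have t: "0 < t" by (auto simp: max_def split: if_splits)
  interpret m: nonneg_variable "configurations {1..m}" "energy m" by (rule nonneg_variable_energy)
  define A where "A = occ_ge {1..m} (\<lambda>a. m div N * n a)"
  define k r where "k = real (m div N)" and "r = real (m mod N)"
  have A: "A \<in> sets (configurations {1..m})" unfolding A_def by measurable
  have mr: "real m = k * real N + r"
    using N by (auto simp: k_def r_def simp flip: of_nat_mult of_nat_add)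
  have "(?J / (real N + 1) ^ K) ^ (m div N) \<le> (t powr (3 * real N / 2) * Q) ^ (m div N)"
    using J t pos by (intro power_mono) (auto simp: t_def Q_def)
  also have "\<dots> = t powr (3 * real N / 2 * k) * Q ^ (m div N)"
    using t by (simp add: power_mult_distrib k_def powr_powr flip: powr_realpow[of "t powr _"])
  also have "\<dots> \<le> (t + \<delta>) powr (3 * real N / 2 * k) * measure (configurations {1..m}) A"
  proof (intro mult_mono powr_mono2)
    show "Q ^ (m div N) \<le> measure (configurations {1..m}) A"
      using measure_occ_ge_power[of N n "m div N" "m mod N"] by (simp add: Q_def A_def)
  qed (use t \<delta> in \<open>auto simp: Q_def k_def\<close>)
  finally have "(?J / (real N + 1) ^ K) ^ (m div N) * \<delta> powr (3 * r / 2)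
      \<le> (t + \<delta>) powr (3 * real N / 2 * k) * measure (configurations {1..m}) A * (t + \<delta>) powr (3 * r / 2)"
    using t \<delta> by (intro mult_mono powr_mono2) (auto simp: r_def)
  also have "\<dots> = (t + \<delta>) powr (3 * real m / 2) * measure (configurations {1..m}) A"
    by (simp add: mr powr_add[symmetric] algebra_simps add_divide_distrib)
  also have "\<dots> = (LINT q|configurations {1..m}. (t + \<delta>) powr (3 * real m / 2) * indicator A q)"
    using A by simp
  also have "\<dots> \<le> truncated_moment (configurations {1..m}) (energy m) (3 * real m / 2) (e + 3 * \<delta>)"
    unfolding truncated_moment_def
  proof (intro integral_mono m.integrable_truncated_power integrable_mult_right integrable_real_indicator A)
    fix q
    show "(t + \<delta>) powr (3 * real m / 2) * indicator A q \<le> max 0 (e + 3 * \<delta> - energy m q) powr (3 * real m / 2)"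
    proof (cases "q \<in> A")
      case True
      then have "energy m q \<le> quad n / (2 * (real N)\<^sup>2) + \<delta>"
        using N n m unfolding A_def by (intro energy_le_of_occ_ge) auto
      then show ?thesis
        using True t \<delta> by (auto simp: t_def intro!: powr_mono2)
    qed auto
  qed (use m.emeasure_finite[of A] in \<open>auto simp: less_top[symmetric]\<close>)
  finally show ?thesis by (simp add: r_def)
qed

end

section \<open>Continuous potentials on bounded domains\<close>

text \<open>The logarithm of \<open>truncated_moment_superadditive\<close>. The constant in front of
  \<open>ln (real N + 1)\<close> is the number of cells, which depends on \<delta> but on neither
  \<open>N\<close> nor \<open>e\<close>.\<close>

lemma (in mean_field) moment_sequence_energy:
  assumes discretizable: "\<And>\<delta>. 0 < \<delta> \<Longrightarrow> \<exists>K \<phi> w. discretized_mean_field P u B \<delta> K \<phi> w"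
    and E_pos: "\<And>e. e \<in> E \<Longrightarrow> 0 < e"
    and E_up: "\<And>e e'. e \<in> E \<Longrightarrow> e \<le> e' \<Longrightarrow> e' \<in> E"
    and E_down: "\<And>e. e \<in> E \<Longrightarrow> \<exists>d>0. e - d \<in> E"
    and prob_pos: "\<And>e N. e \<in> E \<Longrightarrow> 1 \<le> N \<Longrightarrow>
      0 < measure (configurations {1..N}) {q \<in> space (configurations {1..N}). energy N q < e}"
  shows "moment_sequence (\<lambda>N. configurations {1..N}) energy E"
proof (rule moment_sequence.intro)
  show "nonneg_variable (configurations {1..N}) (energy N)" for N
    by (rule nonneg_variable_energy)
  show pos: "0 < truncated_moment (configurations {1..N}) (energy N) a e" if "e \<in> E" "1 \<le> N" "0 \<le> a" for e N a
    using that by (intro nonneg_variable.truncated_moment_pos nonneg_variable_energy prob_pos) auto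
  fix \<delta> :: real assume \<delta>: "0 < \<delta>"
  then obtain K \<phi> w where "discretized_mean_field P u B \<delta> K \<phi> w" using discretizable by blast
  then interpret discretized_mean_field P u B \<delta> K \<phi> w .
  let ?J = "\<lambda>N. truncated_moment (configurations {1..N}) (energy N) (3 * real N / 2)"
  have "\<forall>\<^sub>F N in sequentially. B / \<delta> \<le> real N"
    by (rule eventually_sequentiallyI[of "nat \<lceil>B / \<delta>\<rceil>"]) linarith
  then have "\<forall>\<^sub>F N in sequentially. \<forall>e\<in>E. \<forall>\<^sub>F m in sequentially.
      real (m div N) * (ln (?J N e) - real K * ln (real N + 1)) + 3 * real (m mod N) / 2 * ln \<delta>
      \<le> ln (?J m (e + 3 * \<delta>))"
    using eventually_ge_at_top[of 1]
  proof eventually_elim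
    case (elim N)
    show ?case
    proof
      fix e assume e: "e \<in> E"
      have "\<forall>\<^sub>F m in sequentially. 2 * real N * B / \<delta> \<le> real m"
        by (rule eventually_sequentiallyI[of "nat \<lceil>2 * real N * B / \<delta>\<rceil>"]) linarith
      then show "\<forall>\<^sub>F m in sequentially.
          real (m div N) * (ln (?J N e) - real K * ln (real N + 1)) + 3 * real (m mod N) / 2 * ln \<delta>
          \<le> ln (?J m (e + 3 * \<delta>))"
        using eventually_ge_at_top[of N]
      proof eventually_elim
        case (elim m)
        have J: "0 < ?J N e" using e \<open>1 \<le> N\<close> by (intro pos) auto
        have "ln ((?J N e / (real N + 1) ^ K) ^ (m div N) * \<delta> powr (3 * real (m mod N) / 2)) \<le> ln (?J m (e + 3 * \<delta>))"
          using J \<delta> \<open>1 \<le> N\<close> elim \<open>B / \<delta> \<le> real N\<close>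
          by (intro ln_mono truncated_moment_superadditive mult_pos_pos zero_less_power divide_pos_pos)
            (auto simp: field_simps)
        moreover have "ln ((?J N e / (real N + 1) ^ K) ^ (m div N) * \<delta> powr (3 * real (m mod N) / 2))
            = real (m div N) * (ln (?J N e) - real K * ln (real N + 1)) + 3 * real (m mod N) / 2 * ln \<delta>"
        proof -
          have X: "0 < ?J N e / (real N + 1) ^ K" using J by simp
          then have "ln ((?J N e / (real N + 1) ^ K) ^ (m div N) * \<delta> powr (3 * real (m mod N) / 2))
              = real (m div N) * ln (?J N e / (real N + 1) ^ K) + 3 * real (m mod N) / 2 * ln \<delta>"
            using \<delta> by (subst ln_mult_pos) (auto simp: ln_realpow ln_powr)
          also have "ln (?J N e / (real N + 1) ^ K) = ln (?J N e) - real K * ln (real N + 1)"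
            using J by (subst ln_div) (auto simp: ln_realpow)
          finally show ?thesis .
        qed
        ultimately show ?case by simp
      qed
    qed
  qed
  then show "\<exists>K. \<forall>\<^sub>F N in sequentially. \<forall>e\<in>E. \<forall>\<^sub>F m in sequentially.
      real (m div N) * (ln (?J N e) - K * ln (real N + 1)) + 3 * real (m mod N) / 2 * ln \<delta>
      \<le> ln (?J m (e + 3 * \<delta>))" by blast
qed (auto intro: E_pos E_up E_down)

lemma emeasure_lborel_open_nonzero:
  fixes S :: "'a::euclidean_space set"
  assumes "open S" "S \<noteq> {}"
  shows "emeasure lborel S \<noteq> 0"
proof
  assume "emeasure lborel S = 0"
  with \<open>open S\<close> have "S \<in> null_sets lborel" by (simp add: null_sets_def)
  then have "negligible S" by (simp add: negligible_iff_null_sets null_sets_completionI)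
  with open_not_negligible[OF assms] show False by contradiction
qed

locale confined_potential =
  fixes \<Lambda> :: "'a::euclidean_space set" and f :: "'a \<Rightarrow> 'a \<Rightarrow> real"
  assumes bounded_\<Lambda>: "bounded \<Lambda>" and open_\<Lambda>: "open \<Lambda>" and nonempty: "\<Lambda> \<noteq> {}"
    and f_nonneg: "0 \<le> f x y" and f_sym: "f x y = f y x"
    and continuous_f: "continuous_on (closure \<Lambda> \<times> closure \<Lambda>) (\<lambda>(x, y). f x y)"
begin

text \<open>Nothing is known about the measurability or boundedness of \<open>f\<close> off the
  closure of \<Lambda>. Cutting off by zero gives a function with the global properties that
  \<open>mean_field\<close> asks for, and the positions lie in \<Lambda> almost surely.\<close>

definition pair_energy :: "'a \<Rightarrow> 'a \<Rightarrow> real" where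
  "pair_energy x y = (if x \<in> \<Lambda> \<and> y \<in> \<Lambda> then f x y else 0)"

definition pair_bound :: real where
  "pair_bound = (SUP (x, y)\<in>closure \<Lambda> \<times> closure \<Lambda>. f x y)"

lemma measurable_\<Lambda>[measurable]: "\<Lambda> \<in> sets borel" using open_\<Lambda> by simp

lemma volume_\<Lambda>: "emeasure lborel \<Lambda> \<noteq> 0" "emeasure lborel \<Lambda> \<noteq> \<infinity>"
  using emeasure_lborel_open_nonzero[OF open_\<Lambda> nonempty] emeasure_bounded_finite[OF bounded_\<Lambda>] by auto

definition uniform_position :: "'a measure" where
  "uniform_position = uniform_measure lborel \<Lambda>"

lemma sets_uniform_position[measurable_cong, simp]: "sets uniform_position = sets borel"
  by (simp add: uniform_position_def)

lemma space_uniform_position[simp]: "space uniform_position = UNIV"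
  by (simp add: uniform_position_def)

lemma compact_square: "compact (closure \<Lambda> \<times> closure \<Lambda>)"
  using bounded_\<Lambda> by (intro compact_Times) auto

lemma f_le: "x \<in> closure \<Lambda> \<Longrightarrow> y \<in> closure \<Lambda> \<Longrightarrow> f x y \<le> pair_bound"
  unfolding pair_bound_def
  by (rule cSUP_upper2[of _ _ "(x, y)"])
    (auto intro!: bounded_imp_bdd_above compact_imp_bounded compact_continuous_image continuous_f compact_square)

lemma f_uniformly_continuous:
  assumes "0 < \<eta>"
  shows "\<exists>d>0. \<forall>x\<in>closure \<Lambda>. \<forall>y\<in>closure \<Lambda>. \<forall>x'\<in>closure \<Lambda>. \<forall>y'\<in>closure \<Lambda>.
    dist x x' < d \<longrightarrow> dist y y' < d \<longrightarrow> \<bar>f x y - f x' y'\<bar> < \<eta>"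
proof -
  have "uniformly_continuous_on (closure \<Lambda> \<times> closure \<Lambda>) (\<lambda>(x, y). f x y)"
    by (rule compact_uniformly_continuous[OF continuous_f compact_square])
  with assms obtain d where d: "d > 0" "\<And>z z'. z \<in> closure \<Lambda> \<times> closure \<Lambda> \<Longrightarrow> z' \<in> closure \<Lambda> \<times> closure \<Lambda> \<Longrightarrow>
      dist z' z < d \<Longrightarrow> dist ((\<lambda>(x, y). f x y) z') ((\<lambda>(x, y). f x y) z) < \<eta>"
    unfolding uniformly_continuous_on_def by metis
  have "\<bar>f x y - f x' y'\<bar> < \<eta>"
    if "x \<in> closure \<Lambda>" "y \<in> closure \<Lambda>" "x' \<in> closure \<Lambda>" "y' \<in> closure \<Lambda>" "dist x x' < d / 2" "dist y y' < d / 2" for x y x' y'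
  proof -
    have "dist (x, y) (x', y') \<le> dist x x' + dist y y'"
      unfolding dist_Pair_Pair by (rule sqrt_sum_squares_le_sum) auto
    then show ?thesis using d(2)[of "(x', y')" "(x, y)"] that by (auto simp: dist_real_def)
  qed
  then show ?thesis using d(1) by (intro exI[of _ "d / 2"]) auto
qed

lemma mean_field: "mean_field uniform_position pair_energy pair_bound"
proof (rule mean_field.intro)
  show "prob_space uniform_position"
    unfolding uniform_position_def using volume_\<Lambda> by (intro prob_space_uniform_measure)
  have "(\<lambda>z. indicator (\<Lambda> \<times> \<Lambda>) z *\<^sub>R (case z of (x, y) \<Rightarrow> f x y)) \<in> borel_measurable borel"
    using open_\<Lambda> continuous_f closure_subset[of \<Lambda>]
    by (intro borel_measurable_continuous_on_indicator) (auto intro!: borel_open open_Times elim!: continuous_on_subset)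
  also have "(\<lambda>z. indicator (\<Lambda> \<times> \<Lambda>) z *\<^sub>R (case z of (x, y) \<Rightarrow> f x y)) = (\<lambda>(x, y). pair_energy x y)"
    by (auto simp: fun_eq_iff pair_energy_def indicator_def)
  finally show "(\<lambda>(x, y). pair_energy x y) \<in> borel_measurable (uniform_position \<Otimes>\<^sub>M uniform_position)"
    by (simp add: borel_prod[symmetric] cong: measurable_cong_sets)
  show "pair_energy x y \<le> pair_bound" for x y
  proof -
    obtain z where "z \<in> \<Lambda>" using nonempty by blast
    then have "0 \<le> pair_bound" using f_nonneg[of z z] f_le[of z z] closure_subset[of \<Lambda>] by force
    then show ?thesis using f_le closure_subset[of \<Lambda>] by (auto simp: pair_energy_def)
  qed
qed (auto simp: pair_energy_def f_sym f_nonneg)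

sublocale mean_field uniform_position pair_energy pair_bound by (rule mean_field)

lemma discretizable:
  assumes "0 < \<delta>"
  shows "\<exists>K \<phi> w. discretized_mean_field uniform_position pair_energy pair_bound \<delta> K \<phi> w"
proof -
  obtain d where d: "d > 0" and cont: "\<And>x y x' y'. x \<in> closure \<Lambda> \<Longrightarrow> y \<in> closure \<Lambda> \<Longrightarrow> x' \<in> closure \<Lambda> \<Longrightarrow> y' \<in> closure \<Lambda> \<Longrightarrow>
    dist x x' < d \<Longrightarrow> dist y y' < d \<Longrightarrow> \<bar>f x y - f x' y'\<bar> < \<delta>"
    using f_uniformly_continuous[OF assms] by metis
  \<comment> \<open>Compactness is that of the closure, but the centres are taken in \<Lambda>
    itself, so that \<open>pair_energy\<close> at two centres is a value of \<open>f\<close> and not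
    the default zero.\<close>
  have "closure \<Lambda> \<subseteq> (\<Union>x\<in>\<Lambda>. ball x d)"
    using d by (auto simp: closure_approachable dist_commute)
  then obtain R where R: "R \<subseteq> \<Lambda>" "finite R" "closure \<Lambda> \<subseteq> (\<Union>x\<in>R. ball x d)"
    using compactE_image[of "closure \<Lambda>" \<Lambda> "\<lambda>x. ball x d"] bounded_\<Lambda> by auto
  obtain k :: nat and r where r: "R = r ` {i. i < k}"
    using finite_imp_nat_seg_image_inj_on[OF R(2)] by auto
  \<comment> \<open>The label \<open>k\<close> is an extra cell for the points outside \<Lambda>;
    there \<open>pair_energy\<close> and \<open>w\<close> both vanish.\<close>
  define \<phi> where "\<phi> x = (if x \<in> \<Lambda> then (LEAST i. i < k \<and> dist (r i) x < d) else k)" for x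
  define w where "w a b = (if a < k \<and> b < k then pair_energy (r a) (r b) else 0)" for a b
  have \<phi>: "\<phi> x < k \<and> dist (r (\<phi> x)) x < d" if "x \<in> \<Lambda>" for x
  proof -
    have "x \<in> (\<Union>x\<in>R. ball x d)" using that R(3) closure_subset[of \<Lambda>] by blast
    then have "\<exists>i. i < k \<and> dist (r i) x < d" by (auto simp: r)
    from LeastI_ex[OF this] show ?thesis using that by (simp add: \<phi>_def)
  qed
  have "discretized_mean_field uniform_position pair_energy pair_bound \<delta> (Suc k) \<phi> w"
  proof
    show "\<phi> \<in> uniform_position \<rightarrow>\<^sub>M count_space UNIV" unfolding \<phi>_def by measurable
    show "\<phi> x < Suc k" for x using \<phi>[of x] by (cases "x \<in> \<Lambda>") (auto simp: \<phi>_def)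
    show "0 \<le> w a b" "w a b \<le> pair_bound" for a b
      using order.trans[OF u_nonneg u_le] by (auto simp: w_def u_nonneg u_le)
    fix x y
    show "\<bar>pair_energy x y - w (\<phi> x) (\<phi> y)\<bar> \<le> \<delta>"
    proof (cases "x \<in> \<Lambda> \<and> y \<in> \<Lambda>")
      case True
      then have *: "r (\<phi> x) \<in> \<Lambda>" "r (\<phi> y) \<in> \<Lambda>" using \<phi>[of x] \<phi>[of y] R(1) r by auto
      then have "w (\<phi> x) (\<phi> y) = f (r (\<phi> x)) (r (\<phi> y))"
        using True \<phi> by (simp add: w_def pair_energy_def)
      moreover have "\<bar>f x y - f (r (\<phi> x)) (r (\<phi> y))\<bar> < \<delta>"
        using True * \<phi>[of x] \<phi>[of y] closure_subset[of \<Lambda>] by (intro cont) (auto simp: dist_commute)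
      ultimately show ?thesis using True by (simp add: pair_energy_def)
    next
      case False
      then have "w (\<phi> x) (\<phi> y) = 0" by (auto simp: w_def \<phi>_def)
      with False show ?thesis using assms by (auto simp: pair_energy_def)
    qed
  qed fact
  then show ?thesis by blast
qed

lemma uniform_position_ball_pos:
  assumes "x \<in> \<Lambda>" "0 < r"
  shows "0 < emeasure uniform_position (ball x r \<inter> \<Lambda>)"
proof -
  have "open (ball x r \<inter> \<Lambda>)" "x \<in> ball x r \<inter> \<Lambda>" using assms open_\<Lambda> by auto
  then have "emeasure lborel (ball x r \<inter> \<Lambda>) \<noteq> 0" by (metis emeasure_lborel_open_nonzero empty_iff)
  moreover have "\<Lambda> \<inter> (ball x r \<inter> \<Lambda>) = ball x r \<inter> \<Lambda>" by auto
  ultimately show ?thesis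
    using volume_\<Lambda> by (simp add: uniform_position_def ennreal_zero_less_divide less_top[symmetric] zero_less_iff_neq_zero)
qed

text \<open>By uniform continuity a whole box of configurations around \<open>x\<close> stays below
  \<open>e\<close>. The box has positive probability because each side is a ball around a point of
  the open set \<Lambda>.\<close>

lemma energy_less_prob_pos:
  assumes N: "1 \<le> N" and x: "\<And>i. i \<in> {1..N} \<Longrightarrow> x i \<in> \<Lambda>" "energy N x < e"
  shows "0 < measure (configurations {1..N}) {q \<in> space (configurations {1..N}). energy N q < e}"
proof -
  interpret nonneg_variable "configurations {1..N}" "energy N" by (rule nonneg_variable_energy)
  interpret P: prob_space uniform_position by (rule prob_space_P)
  interpret PS: product_sigma_finite "\<lambda>_::nat. uniform_position" by unfold_locales
  define \<eta> where "\<eta> = (e - energy N x)"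
  have \<eta>: "0 < \<eta>" using x by (simp add: \<eta>_def)
  then obtain d where d: "d > 0" and cont: "\<And>x y x' y'. x \<in> closure \<Lambda> \<Longrightarrow> y \<in> closure \<Lambda> \<Longrightarrow> x' \<in> closure \<Lambda> \<Longrightarrow> y' \<in> closure \<Lambda> \<Longrightarrow>
    dist x x' < d \<Longrightarrow> dist y y' < d \<Longrightarrow> \<bar>f x y - f x' y'\<bar> < \<eta>"
    using f_uniformly_continuous[of \<eta>] by metis
  define box where "box = (\<Pi>\<^sub>E i\<in>{1..N}. ball (x i) d \<inter> \<Lambda>)"
  have box_sub: "box \<subseteq> {q \<in> space (configurations {1..N}). energy N q < e}"
  proof
    fix q assume q: "q \<in> box"
    then have q': "q i \<in> \<Lambda>" "dist (x i) (q i) < d" if "i \<in> {1..N}" for i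
      using that by (auto simp: box_def PiE_iff)
    have "(\<Sum>i\<in>{1..N}. \<Sum>j\<in>{i<..N}. pair_energy (q i) (q j)) \<le> (\<Sum>i\<in>{1..N}. \<Sum>j\<in>{i<..N}. pair_energy (x i) (x j) + \<eta>)"
    proof (intro sum_mono)
      fix i j assume "i \<in> {1..N}" "j \<in> {i<..N}"
      then have ij: "i \<in> {1..N}" "j \<in> {1..N}" by auto
      have "\<bar>f (x i) (x j) - f (q i) (q j)\<bar> < \<eta>"
        using q'[OF ij(1)] q'[OF ij(2)] x(1)[OF ij(1)] x(1)[OF ij(2)] closure_subset[of \<Lambda>] by (intro cont) auto
      then show "pair_energy (q i) (q j) \<le> pair_energy (x i) (x j) + \<eta>"
        using q'[OF ij(1)] q'[OF ij(2)] x(1)[OF ij(1)] x(1)[OF ij(2)] by (auto simp: pair_energy_def)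
    qed
    also have "\<dots> = (\<Sum>i\<in>{1..N}. \<Sum>j\<in>{i<..N}. pair_energy (x i) (x j)) + (\<Sum>i\<in>{1..N}. \<Sum>j\<in>{i<..N}. \<eta>)"
      by (simp add: sum.distrib)
    also have "(\<Sum>i\<in>{1..N}. \<Sum>j\<in>{i<..N}. \<eta>) = (\<Sum>i\<in>{1..N}. real (N - i) * \<eta>)" by simp
    \<comment> \<open>Labels start at 1, so each \<open>N - i\<close> is strictly below
      \<open>N\<close>. Fewer than \<open>N\<^sup>2\<close> pairs, each changing by at most
      \<open>\<eta>\<close>, shift \<open>energy\<close> by strictly less than
      \<open>\<eta>\<close>.\<close>
    also have "\<dots> < (\<Sum>i\<in>{1..N}. real N * \<eta>)"
      using N \<eta> by (intro sum_strict_mono mult_strict_right_mono) auto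
    also have "\<dots> = (real N)\<^sup>2 * \<eta>" by (simp add: power2_eq_square)
    finally have "energy N q < energy N x + \<eta>"
      using N by (simp add: energy_def field_simps)
    moreover have "q \<in> space (configurations {1..N})"
      using q by (auto simp: box_def configurations_def space_PiM)
    ultimately show "q \<in> {q \<in> space (configurations {1..N}). energy N q < e}" by (simp add: \<eta>_def)
  qed
  have "emeasure (configurations {1..N}) box = (\<Prod>i\<in>{1..N}. emeasure uniform_position (ball (x i) d \<inter> \<Lambda>))"
    unfolding configurations_def box_def by (rule PS.emeasure_PiM) auto
  moreover have "emeasure uniform_position (ball (x i) d \<inter> \<Lambda>) \<noteq> 0" if "i \<in> {1..N}" for i
    using uniform_position_ball_pos[OF x(1)[OF that] d] by simp
  ultimately have "emeasure (configurations {1..N}) box \<noteq> 0" by (simp add: prod_zero_iff)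
  moreover have "emeasure (configurations {1..N}) box \<le> emeasure (configurations {1..N}) {q \<in> space (configurations {1..N}). energy N q < e}"
    using box_sub by (intro emeasure_mono) measurable
  ultimately have "emeasure (configurations {1..N}) {q \<in> space (configurations {1..N}). energy N q < e} \<noteq> 0"
    by auto
  then show ?thesis unfolding emeasure_eq_measure by (simp add: zero_less_measure_iff)
qed

end

section \<open>Configurations with energy below the mean-field value\<close>

lemma distr_PiM_pair:
  assumes "prob_space M" "i \<in> I" "j \<in> I" "i \<noteq> j"
  shows "distr (\<Pi>\<^sub>M k\<in>I. M) (M \<Otimes>\<^sub>M M) (\<lambda>x. (x i, x j)) = M \<Otimes>\<^sub>M M"
proof (rule pair_measure_eqI[symmetric])
  interpret M: prob_space M by fact
  interpret product_prob_space "\<lambda>_. M" I by unfold_locales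
  show "sigma_finite_measure M" "sigma_finite_measure M" by unfold_locales
  have [measurable]: "(\<lambda>x. (x i, x j)) \<in> (\<Pi>\<^sub>M k\<in>I. M) \<rightarrow>\<^sub>M M \<Otimes>\<^sub>M M"
    using assms by (intro measurable_Pair measurable_component_singleton)
  fix A B assume AB[measurable]: "A \<in> sets M" "B \<in> sets M"
  have "emeasure (distr (\<Pi>\<^sub>M k\<in>I. M) (M \<Otimes>\<^sub>M M) (\<lambda>x. (x i, x j))) (A \<times> B)
      = emeasure (\<Pi>\<^sub>M k\<in>I. M) ((\<lambda>x. (x i, x j)) -` (A \<times> B) \<inter> space (\<Pi>\<^sub>M k\<in>I. M))"
    by (rule emeasure_distr) measurable
  also have "(\<lambda>x. (x i, x j)) -` (A \<times> B) \<inter> space (\<Pi>\<^sub>M k\<in>I. M)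
      = {x \<in> space (\<Pi>\<^sub>M k\<in>I. M). \<forall>k\<in>{i, j}. x k \<in> (if k = i then A else B)}"
    using assms by auto
  also have "emeasure (\<Pi>\<^sub>M k\<in>I. M) \<dots> = (\<Prod>k\<in>{i, j}. emeasure M (if k = i then A else B))"
    using assms AB by (intro emeasure_PiM_Collect) auto
  also have "\<dots> = emeasure M A * emeasure M B" using assms by simp
  finally show "emeasure M A * emeasure M B = emeasure (distr (\<Pi>\<^sub>M k\<in>I. M) (M \<Otimes>\<^sub>M M) (\<lambda>x. (x i, x j))) (A \<times> B)" ..
qed simp

context confined_potential
begin

text \<open>The average of the energy over independent samples of \<open>\<mu>\<close> is below \<open>e\<close>.\<close>

lemma low_energy_configuration:
  assumes "prob_space \<mu>" and sets_\<mu>: "sets \<mu> = sets (restrict_space borel \<Lambda>)"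
    and I: "(\<integral>\<^sup>+ x. \<integral>\<^sup>+ y. ennreal (1 / 2 * f x y) \<partial>\<mu> \<partial>\<mu>) < ennreal e" and N: "1 \<le> N"
  shows "\<exists>x. (\<forall>i\<in>{1..N}. x i \<in> \<Lambda>) \<and> energy N x < e"
proof (rule ccontr)
  assume "\<not> ?thesis"
  then have large: "e \<le> energy N x" if "\<forall>i\<in>{1..N}. x i \<in> \<Lambda>" for x
    using that by (meson not_less)
  interpret \<mu>: prob_space \<mu> by fact
  let ?M = "\<Pi>\<^sub>M k\<in>{1..N}. \<mu>"
  interpret M: prob_space ?M by (intro prob_space_PiM) unfold_locales
  have space_\<mu>: "space \<mu> = \<Lambda>" using sets_eq_imp_space_eq[OF sets_\<mu>] by (simp add: space_restrict_space)
  \<comment> \<open>The measure \<open>\<mu>\<close> carries the trace sigma-algebra on \<Lambda>,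
    whereas \<open>pair_energy\<close> is measurable for Borel sets of the whole space; the
    inclusion map mediates.\<close>
  have id: "(\<lambda>x. x) \<in> \<mu> \<rightarrow>\<^sub>M uniform_position"
    unfolding measurable_cong_sets[OF sets_\<mu> sets_uniform_position]
    by (intro measurable_restrict_space1 measurable_ident_sets refl)
  have "(\<lambda>z. (fst z, snd z)) \<in> \<mu> \<Otimes>\<^sub>M \<mu> \<rightarrow>\<^sub>M uniform_position \<Otimes>\<^sub>M uniform_position"
    by (intro measurable_Pair measurable_compose[OF measurable_fst id] measurable_compose[OF measurable_snd id])
  from measurable_compose[OF this measurable_u]
  have u[measurable]: "(\<lambda>z. pair_energy (fst z) (snd z)) \<in> borel_measurable (\<mu> \<Otimes>\<^sub>M \<mu>)" by simp
  define J where "J = (\<integral>\<^sup>+ x. \<integral>\<^sup>+ y. ennreal (f x y) \<partial>\<mu> \<partial>\<mu>)"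
  have fst: "(\<integral>\<^sup>+ z. ennreal (c * pair_energy (fst z) (snd z)) \<partial>(\<mu> \<Otimes>\<^sub>M \<mu>)) = (\<integral>\<^sup>+ x. \<integral>\<^sup>+ y. ennreal (c * f x y) \<partial>\<mu> \<partial>\<mu>)" for c
  proof -
    have "(\<integral>\<^sup>+ z. ennreal (c * pair_energy (fst z) (snd z)) \<partial>(\<mu> \<Otimes>\<^sub>M \<mu>)) = (\<integral>\<^sup>+ x. \<integral>\<^sup>+ y. ennreal (c * pair_energy x y) \<partial>\<mu> \<partial>\<mu>)"
      using \<mu>.nn_integral_fst[of "\<lambda>z. ennreal (c * pair_energy (fst z) (snd z))" \<mu>] u by simp
    also have "\<dots> = (\<integral>\<^sup>+ x. \<integral>\<^sup>+ y. ennreal (c * f x y) \<partial>\<mu> \<partial>\<mu>)"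
      by (intro nn_integral_cong) (auto simp: space_\<mu> pair_energy_def)
    finally show ?thesis .
  qed
  have J_pair: "(\<integral>\<^sup>+ z. ennreal (pair_energy (fst z) (snd z)) \<partial>(\<mu> \<Otimes>\<^sub>M \<mu>)) = J"
    using fst[of 1] by (simp add: J_def)
  have J: "J < ennreal (2 * e)"
  proof (rule ccontr)
    assume "\<not> ?thesis"
    then have "ennreal (1 / 2) * ennreal (2 * e) \<le> ennreal (1 / 2) * J" by (intro mult_left_mono) auto
    also have "\<dots> = (\<integral>\<^sup>+ z. ennreal (1 / 2) * ennreal (pair_energy (fst z) (snd z)) \<partial>(\<mu> \<Otimes>\<^sub>M \<mu>))"
      unfolding J_pair[symmetric] by (rule nn_integral_cmult[symmetric]) (use u in simp)
    also have "\<dots> = (\<integral>\<^sup>+ x. \<integral>\<^sup>+ y. ennreal (1 / 2 * f x y) \<partial>\<mu> \<partial>\<mu>)"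
      unfolding fst[symmetric] by (intro nn_integral_cong ennreal_mult'[symmetric]) auto
    also have "ennreal (1 / 2) * ennreal (2 * e) = ennreal e"
      by (subst ennreal_mult'[symmetric]) auto
    finally show False using I by simp
  qed
  have pair: "(\<integral>\<^sup>+ x. ennreal (pair_energy (x i) (x j)) \<partial>?M) = J" if "i \<in> {1..N}" "j \<in> {i<..N}" for i j
  proof -
    have ij: "i \<in> {1..N}" "j \<in> {1..N}" "i \<noteq> j" using that by auto
    have p: "(\<lambda>x. (x i, x j)) \<in> ?M \<rightarrow>\<^sub>M \<mu> \<Otimes>\<^sub>M \<mu>"
      using ij by (intro measurable_Pair measurable_component_singleton)
    have d: "distr ?M (\<mu> \<Otimes>\<^sub>M \<mu>) (\<lambda>x. (x i, x j)) = \<mu> \<Otimes>\<^sub>M \<mu>"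
      using ij by (intro distr_PiM_pair assms(1))
    have "(\<integral>\<^sup>+ x. ennreal (pair_energy (x i) (x j)) \<partial>?M)
        = (\<integral>\<^sup>+ z. ennreal (pair_energy (fst z) (snd z)) \<partial>(distr ?M (\<mu> \<Otimes>\<^sub>M \<mu>) (\<lambda>x. (x i, x j))))"
      using nn_integral_distr[OF p, of "\<lambda>z. ennreal (pair_energy (fst z) (snd z))"] u by simp
    also have "\<dots> = J" by (simp only: d J_pair)
    finally show ?thesis .
  qed
  have me: "(\<lambda>x. ennreal (pair_energy (x i) (x j))) \<in> borel_measurable ?M" if "i \<in> {1..N}" "j \<in> {i<..N}" for i j
  proof -
    have "(\<lambda>x. (x i, x j)) \<in> ?M \<rightarrow>\<^sub>M \<mu> \<Otimes>\<^sub>M \<mu>"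
      using that by (intro measurable_Pair measurable_component_singleton) auto
    from measurable_compose[OF this u] show ?thesis by simp
  qed
  have "ennreal ((real N)\<^sup>2 * e) = (\<integral>\<^sup>+ x. ennreal ((real N)\<^sup>2 * e) \<partial>?M)" 
    using M.emeasure_space_1 by simp
  also have "\<dots> \<le> (\<integral>\<^sup>+ x. (\<Sum>i\<in>{1..N}. \<Sum>j\<in>{i<..N}. ennreal (pair_energy (x i) (x j))) \<partial>?M)"
  proof (rule nn_integral_mono)
    fix x assume "x \<in> space ?M"
    then have "e \<le> energy N x" by (intro large) (auto simp: space_PiM space_\<mu>)
    then have "(real N)\<^sup>2 * e \<le> (\<Sum>i\<in>{1..N}. \<Sum>j\<in>{i<..N}. pair_energy (x i) (x j))"
      using N by (simp add: energy_def field_simps)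
    then show "ennreal ((real N)\<^sup>2 * e) \<le> (\<Sum>i\<in>{1..N}. \<Sum>j\<in>{i<..N}. ennreal (pair_energy (x i) (x j)))"
      by (simp add: sum_ennreal u_nonneg sum_nonneg ennreal_leI)
  qed
  also have "\<dots> = (\<Sum>i\<in>{1..N}. \<integral>\<^sup>+ x. (\<Sum>j\<in>{i<..N}. ennreal (pair_energy (x i) (x j))) \<partial>?M)"
    by (intro nn_integral_sum borel_measurable_sum me)
  also have "\<dots> = (\<Sum>i\<in>{1..N}. \<Sum>j\<in>{i<..N}. \<integral>\<^sup>+ x. ennreal (pair_energy (x i) (x j)) \<partial>?M)"
    by (intro sum.cong refl nn_integral_sum me)
  also have "\<dots> = (\<Sum>i\<in>{1..N}. \<Sum>j\<in>{i<..N}. J)"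
    by (intro sum.cong refl pair)
  also have "\<dots> \<le> ennreal ((real N)\<^sup>2 / 2) * J"
  proof -
    \<comment> \<open>There are \<open>N * (N - 1) / 2\<close> pairs, no more than
      \<open>N\<^sup>2 / 2\<close>, so the average of \<open>energy\<close> is at most
      \<open>J / 2\<close>, the mean-field energy of \<open>\<mu>\<close>.\<close>
    define c where "c = (\<Sum>i\<in>{1..N}. \<Sum>j\<in>{i<..N}. 1 :: nat)"
    have "real c = (\<Sum>i\<in>{1..N}. \<Sum>j\<in>{i<..N}. 1)" by (simp only: c_def of_nat_sum of_nat_1)
    then have "2 * real c + real N = (real N)\<^sup>2"
      using sum_sum_symmetric[of "\<lambda>_ _. 1" N] by (simp add: power2_eq_square)
    then have "real c \<le> (real N)\<^sup>2 / 2" by linarith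
    then have "ennreal (real c) * J \<le> ennreal ((real N)\<^sup>2 / 2) * J"
      by (intro mult_right_mono ennreal_leI) auto
    moreover have "(\<Sum>i\<in>{1..N}. \<Sum>j\<in>{i<..N}. J) = of_nat c * J"
      by (simp only: c_def of_nat_sum of_nat_1 sum_distrib_right mult_1_left)
    ultimately show ?thesis by (simp add: ennreal_of_nat_eq_real_of_nat)
  qed
  also have "\<dots> < ennreal ((real N)\<^sup>2 / 2) * ennreal (2 * e)"
    using J N by (intro ennreal_mult_strict_left_mono) auto
  also have "\<dots> = ennreal ((real N)\<^sup>2 * e)"
    by (simp flip: ennreal_mult')
  finally show False by simp
qed

end

section \<open>Differentiating truncated moments in the energy\<close>

lemma has_real_derivative_truncated_power:
  fixes a :: real
  assumes "1 < a"
  shows "((\<lambda>y. max 0 y powr a) has_real_derivative a * max 0 y powr (a - 1)) (at y)"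
proof -
  consider "y > 0" | "y < 0" | "y = 0" by linarith
  then show ?thesis
  proof cases
    case 1
    have "((\<lambda>y. y powr a) has_real_derivative a * y powr (a - 1)) (at y)"
      using 1 by (intro has_real_derivative_powr)
    then have "((\<lambda>y. max 0 y powr a) has_real_derivative a * y powr (a - 1)) (at y)"
      by (rule has_field_derivative_transform_within_open[where S = "{0<..}"]) (use 1 in auto)
    then show ?thesis using 1 by simp
  next
    case 2
    have "((\<lambda>y. 0) has_real_derivative 0) (at y)" by simp
    then have "((\<lambda>y. max 0 y powr a) has_real_derivative 0) (at y)"
      by (rule has_field_derivative_transform_within_open[where S = "{..<0}"]) (use 2 in auto)
    then show ?thesis using 2 by simp
  next
    case 3
    \<comment> \<open>At the kink the difference quotient is bounded by this power of
      \<open>h\<close>, which vanishes because \<open>a > 1\<close>.\<close>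
    have "((\<lambda>h. \<bar>h\<bar> powr (a - 1)) \<longlongrightarrow> 0) (at (0::real))"
      by (rule tendsto_zero_powrI[OF tendsto_rabs_zero[OF tendsto_ident_at] tendsto_const])
        (use assms in auto)
    then have "((\<lambda>h. max 0 h powr a / h) \<longlongrightarrow> 0) (at (0::real))"
    proof (rule Lim_null_comparison[rotated])
      show "\<forall>\<^sub>F h in at (0::real). norm (max 0 h powr a / h) \<le> \<bar>h\<bar> powr (a - 1)"
      proof (rule always_eventually, rule allI)
        fix h :: real
        show "norm (max 0 h powr a / h) \<le> \<bar>h\<bar> powr (a - 1)"
        proof (cases "0 < h")
          case True
          then show ?thesis by (simp add: powr_diff)
        qed simp
      qed
    qed
    then show ?thesis using 3 assms by (simp add: DERIV_def)
  qed
qed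

text \<open>Supplies the constant that dominates the difference quotients of the moment.\<close>

lemma truncated_power_lipschitz:
  fixes a :: real
  assumes "1 < a" "x \<le> C" "y \<le> C" "0 \<le> C"
  shows "\<bar>max 0 x powr a - max 0 y powr a\<bar> \<le> a * C powr (a - 1) * \<bar>x - y\<bar>"
proof -
  have "norm (max 0 x powr a - max 0 y powr a) \<le> a * C powr (a - 1) * norm (x - y)"
  proof (rule field_differentiable_bound[where S = "{..C}"])
    fix z assume "z \<in> {..C}"
    then have "max 0 z powr (a - 1) \<le> C powr (a - 1)" using assms by (intro powr_mono2) auto
    then show "norm (a * max 0 z powr (a - 1)) \<le> a * C powr (a - 1)" using assms by (simp add: abs_mult)
    show "((\<lambda>y. max 0 y powr a) has_real_derivative a * max 0 z powr (a - 1)) (at z within {..C})"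
      by (rule has_field_derivative_at_within[OF has_real_derivative_truncated_power[OF assms(1)]])
  qed (use assms in auto)
  then show ?thesis by simp
qed

text \<open>Dominated convergence along sequences. The power \<open>a > 1\<close> smooths enough to
  allow any law of \<open>v\<close>, atoms included.\<close>

lemma (in nonneg_variable) has_real_derivative_truncated_moment:
  assumes a: "1 < a"
  shows "(truncated_moment M v a has_real_derivative a * truncated_moment M v (a - 1) e) (at e)"
  unfolding DERIV_def tendsto_at_iff_sequentially comp_def
proof (intro allI impI)
  fix X :: "nat \<Rightarrow> real" assume X0: "\<forall>i. X i \<in> UNIV - {0}" and X: "X \<longlonglongrightarrow> 0"
  \<comment> \<open>Since \<open>v\<close> is nonnegative, both arguments of the truncated power
    stay below \<open>\<bar>e\<bar> + C\<close>, so one Lipschitz constant serves the whole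
    sequence.\<close>
  obtain C where C: "\<And>i. \<bar>X i\<bar> \<le> C" using convergent_imp_Bseq[OF convergentI[OF X]] by (auto simp: Bseq_def)
  have C0: "0 \<le> C" using C[of 0] by linarith
  let ?D = "\<lambda>i x. (max 0 (e + X i - v x) powr a - max 0 (e - v x) powr a) / X i"
  have "(\<lambda>i. LINT x|M. ?D i x) \<longlonglongrightarrow> (LINT x|M. a * max 0 (e - v x) powr (a - 1))"
  proof (rule integral_dominated_convergence)
    show "integrable M (\<lambda>_. a * (\<bar>e\<bar> + C) powr (a - 1))" by simp
    show "AE x in M. (\<lambda>i. ?D i x) \<longlonglongrightarrow> a * max 0 (e - v x) powr (a - 1)"
    proof (rule AE_I2)
      fix x
      have "((\<lambda>h. (max 0 (e - v x + h) powr a - max 0 (e - v x) powr a) / h) \<longlongrightarrow> a * max 0 (e - v x) powr (a - 1)) (at 0)"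
        using has_real_derivative_truncated_power[OF a] by (simp add: DERIV_def)
      then have "(\<lambda>i. (max 0 (e - v x + X i) powr a - max 0 (e - v x) powr a) / X i) \<longlonglongrightarrow> a * max 0 (e - v x) powr (a - 1)"
        using X X0 unfolding tendsto_at_iff_sequentially comp_def by blast
      then show "(\<lambda>i. ?D i x) \<longlonglongrightarrow> a * max 0 (e - v x) powr (a - 1)" by (simp add: algebra_simps)
    qed
    show "AE x in M. norm (?D i x) \<le> a * (\<bar>e\<bar> + C) powr (a - 1)" for i
    proof (rule AE_I2)
      fix x assume x: "x \<in> space M"
      have "\<bar>max 0 (e + X i - v x) powr a - max 0 (e - v x) powr a\<bar> \<le> a * (\<bar>e\<bar> + C) powr (a - 1) * \<bar>e + X i - v x - (e - v x)\<bar>"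
        using a C[of i] v_nonneg[OF x] by (intro truncated_power_lipschitz) auto
      then show "norm (?D i x) \<le> a * (\<bar>e\<bar> + C) powr (a - 1)"
        using X0 by (simp add: divide_le_eq)
    qed
  qed measurable
  moreover have "(LINT x|M. ?D i x) = (truncated_moment M v a (e + X i) - truncated_moment M v a e) / X i" for i
    using a integrable_truncated_power[of a] X0 by (simp add: truncated_moment_def)
  ultimately show "(\<lambda>i. (truncated_moment M v a (e + X i) - truncated_moment M v a e) / X i)
      \<longlonglongrightarrow> a * truncated_moment M v (a - 1) e"
    by (simp only: truncated_moment_def integral_mult_right_zero)
qed

section \<open>Integration over the momenta\<close>

text \<open>A phase point stores the momentum and position of each particle together, while Fubini
  needs all momenta apart from all positions. The regrouping is checked on boxes whose sides are
  arbitrary sets of pairs: the integral over the second components factorises inside the one over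
  the first.\<close>

lemma distr_PiM_pair_measure:
  assumes "sigma_finite_measure M" "sigma_finite_measure M'" "finite I"
  shows "distr ((\<Pi>\<^sub>M i\<in>I. M) \<Otimes>\<^sub>M (\<Pi>\<^sub>M i\<in>I. M')) (\<Pi>\<^sub>M i\<in>I. M \<Otimes>\<^sub>M M') (\<lambda>(p, q). \<lambda>i\<in>I. (p i, q i))
    = (\<Pi>\<^sub>M i\<in>I. M \<Otimes>\<^sub>M M')"
proof -
  interpret M: sigma_finite_measure M by fact
  interpret M': sigma_finite_measure M' by fact
  interpret MM: pair_sigma_finite M M' ..
  interpret PM: product_sigma_finite "\<lambda>_. M" by unfold_locales
  interpret PM': product_sigma_finite "\<lambda>_. M'" by unfold_locales
  interpret PMM: product_sigma_finite "\<lambda>_. M \<Otimes>\<^sub>M M'" by unfold_locales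
  interpret FM: finite_product_sigma_finite "\<lambda>_. M" I by standard fact
  interpret FM': finite_product_sigma_finite "\<lambda>_. M'" I by standard fact
  interpret PP: pair_sigma_finite "\<Pi>\<^sub>M i\<in>I. M" "\<Pi>\<^sub>M i\<in>I. M'"
    by (intro pair_sigma_finite.intro FM.sigma_finite_measure_axioms FM'.sigma_finite_measure_axioms)
  let ?t = "\<lambda>(p, q). \<lambda>i\<in>I. (p i, q i)"
  let ?P = "(\<Pi>\<^sub>M i\<in>I. M) \<Otimes>\<^sub>M (\<Pi>\<^sub>M i\<in>I. M')"
  have t: "?t \<in> ?P \<rightarrow>\<^sub>M (\<Pi>\<^sub>M i\<in>I. M \<Otimes>\<^sub>M M')"
    by measurable
  show ?thesis
  proof (rule PMM.PiM_eqI)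
    fix A assume A: "\<And>i. i \<in> I \<Longrightarrow> A i \<in> sets (M \<Otimes>\<^sub>M M')"
    then have ind[measurable]: "i \<in> I \<Longrightarrow> (\<lambda>z. indicator (A i) z :: ennreal) \<in> borel_measurable (M \<Otimes>\<^sub>M M')" for i
      by (intro borel_measurable_indicator)
    have S: "?t -` (\<Pi>\<^sub>E i\<in>I. A i) \<inter> space ?P \<in> sets ?P"
      using A assms by (intro measurable_sets[OF t] sets_PiM_I_finite)
    have "emeasure (distr ?P (\<Pi>\<^sub>M i\<in>I. M \<Otimes>\<^sub>M M') ?t) (\<Pi>\<^sub>E i\<in>I. A i) = emeasure ?P (?t -` (\<Pi>\<^sub>E i\<in>I. A i) \<inter> space ?P)"
      using A assms by (intro emeasure_distr t sets_PiM_I_finite)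
    also have "\<dots> = (\<integral>\<^sup>+ z. indicator (?t -` (\<Pi>\<^sub>E i\<in>I. A i) \<inter> space ?P) z \<partial>?P)"
      using S by simp
    also have "\<dots> = (\<integral>\<^sup>+ p. \<integral>\<^sup>+ q. indicator (?t -` (\<Pi>\<^sub>E i\<in>I. A i) \<inter> space ?P) (p, q) \<partial>(\<Pi>\<^sub>M i\<in>I. M') \<partial>(\<Pi>\<^sub>M i\<in>I. M))"
      using S by (intro FM'.nn_integral_fst[symmetric] borel_measurable_indicator)
    also have "\<dots> = (\<integral>\<^sup>+ p. \<integral>\<^sup>+ q. (\<Prod>i\<in>I. indicator (A i) (p i, q i)) \<partial>(\<Pi>\<^sub>M i\<in>I. M') \<partial>(\<Pi>\<^sub>M i\<in>I. M))"
    proof (intro nn_integral_cong)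
      fix p q assume "p \<in> space (\<Pi>\<^sub>M i\<in>I. M)" "q \<in> space (\<Pi>\<^sub>M i\<in>I. M')"
      then show "indicator (?t -` (\<Pi>\<^sub>E i\<in>I. A i) \<inter> space ?P) (p, q) = (\<Prod>i\<in>I. indicator (A i) (p i, q i) :: ennreal)"
        using assms by (auto simp: indicator_def space_pair_measure prod_zero_iff PiE_iff)
    qed
    also have "\<dots> = (\<integral>\<^sup>+ p. (\<Prod>i\<in>I. \<integral>\<^sup>+ y. indicator (A i) (p i, y) \<partial>M') \<partial>(\<Pi>\<^sub>M i\<in>I. M))"
    proof (intro nn_integral_cong PM'.product_nn_integral_prod assms)
      fix p i assume "p \<in> space (\<Pi>\<^sub>M i\<in>I. M)" and i: "i \<in> I"
      then have "p i \<in> space M" by (auto simp: space_PiM)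
      from measurable_compose[OF measurable_Pair1'[OF this] ind[OF i]]
      show "(\<lambda>y. indicator (A i) (p i, y) :: ennreal) \<in> borel_measurable M'" by simp
    qed
    also have "\<dots> = (\<Prod>i\<in>I. \<integral>\<^sup>+ x. \<integral>\<^sup>+ y. indicator (A i) (x, y) \<partial>M' \<partial>M)"
      using assms ind by (intro PM.product_nn_integral_prod M'.borel_measurable_nn_integral_fst) auto
    also have "\<dots> = (\<Prod>i\<in>I. emeasure (M \<Otimes>\<^sub>M M') (A i))"
      using A by (intro prod.cong refl M'.emeasure_pair_measure[symmetric])
    finally show "emeasure (distr ?P (\<Pi>\<^sub>M i\<in>I. M \<Otimes>\<^sub>M M') ?t) (\<Pi>\<^sub>E i\<in>I. A i) = (\<Prod>i\<in>I. emeasure (M \<Otimes>\<^sub>M M') (A i))" .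
  qed (use assms in auto)
qed

section \<open>Dilations and the volume of kinetic-energy balls\<close>

lemma emeasure_lborel_scale:
  fixes A :: "'a::euclidean_space set"
  assumes "0 < s" "A \<in> sets borel"
  shows "emeasure lborel A = ennreal (s ^ DIM('a)) * emeasure lborel ((\<lambda>x. s *\<^sub>R x) -` A)"
proof -
  have "emeasure lborel A = emeasure (density (distr lborel borel (\<lambda>x. 0 + s *\<^sub>R x)) (\<lambda>_. \<bar>s\<bar> ^ DIM('a))) A"
    using assms lborel_affine[of s "0::'a"] by simp
  also have "\<dots> = ennreal (s ^ DIM('a)) * emeasure (distr lborel borel (\<lambda>x. s *\<^sub>R x)) A"
    using assms by (subst emeasure_density) (auto simp: nn_integral_cmult)
  also have "emeasure (distr lborel borel (\<lambda>x. s *\<^sub>R x)) A = emeasure lborel ((\<lambda>x. s *\<^sub>R x) -` A)"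
    using assms by (subst emeasure_distr) auto
  finally show ?thesis .
qed

lemma emeasure_PiM_lborel_scale:
  fixes A :: "('i \<Rightarrow> 'a::euclidean_space) set"
  assumes "0 < s" "finite I" "A \<in> sets (\<Pi>\<^sub>M i\<in>I. lborel)"
  shows "emeasure (\<Pi>\<^sub>M i\<in>I. lborel) A = ennreal (s ^ (DIM('a) * card I)) *
    emeasure (\<Pi>\<^sub>M i\<in>I. lborel) ((\<lambda>p. \<lambda>i\<in>I. s *\<^sub>R p i) -` A \<inter> space (\<Pi>\<^sub>M i\<in>I. (lborel :: 'a measure)))"
proof -
  interpret P: product_sigma_finite "\<lambda>_::'i. lborel :: 'a measure" by unfold_locales
  let ?L = "\<Pi>\<^sub>M i\<in>I. (lborel :: 'a measure)" and ?c = "ennreal (s ^ (DIM('a) * card I))"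
  have t[measurable]: "(\<lambda>p. \<lambda>i\<in>I. s *\<^sub>R p i) \<in> ?L \<rightarrow>\<^sub>M ?L" by measurable
  have "scale_measure ?c (distr ?L ?L (\<lambda>p. \<lambda>i\<in>I. s *\<^sub>R p i)) = ?L"
  proof (rule P.PiM_eqI)
    fix A :: "'i \<Rightarrow> 'a set" assume A: "\<And>i. i \<in> I \<Longrightarrow> A i \<in> sets lborel"
    have "emeasure (distr ?L ?L (\<lambda>p. \<lambda>i\<in>I. s *\<^sub>R p i)) (\<Pi>\<^sub>E i\<in>I. A i)
        = emeasure ?L ((\<lambda>p. \<lambda>i\<in>I. s *\<^sub>R p i) -` (\<Pi>\<^sub>E i\<in>I. A i) \<inter> space ?L)"
      using A assms by (intro emeasure_distr t sets_PiM_I_finite)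
    also have "(\<lambda>p. \<lambda>i\<in>I. s *\<^sub>R p i) -` (\<Pi>\<^sub>E i\<in>I. A i) \<inter> space ?L = (\<Pi>\<^sub>E i\<in>I. (\<lambda>x. s *\<^sub>R x) -` A i)"
      by (auto simp: space_PiM PiE_iff)
    also have "emeasure ?L \<dots> = (\<Prod>i\<in>I. emeasure lborel ((\<lambda>x. s *\<^sub>R x) -` A i))"
    proof (rule P.emeasure_PiM[OF assms(2)])
      fix i assume "i \<in> I"
      then have "A i \<in> sets borel" using A by simp
      from measurable_sets[OF _ this, of "\<lambda>x. s *\<^sub>R x" borel]
      show "(\<lambda>x. s *\<^sub>R x) -` A i \<in> sets lborel" by simp
    qed
    finally have "emeasure (scale_measure ?c (distr ?L ?L (\<lambda>p. \<lambda>i\<in>I. s *\<^sub>R p i))) (\<Pi>\<^sub>E i\<in>I. A i)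
        = ?c * (\<Prod>i\<in>I. emeasure lborel ((\<lambda>x. s *\<^sub>R x) -` A i))"
      by (simp only: emeasure_scale_measure)
    also have "\<dots> = (\<Prod>i\<in>I. ennreal (s ^ DIM('a))) * (\<Prod>i\<in>I. emeasure lborel ((\<lambda>x. s *\<^sub>R x) -` A i))"
      using assms by (simp add: power_mult ennreal_power)
    also have "(\<Prod>i\<in>I. ennreal (s ^ DIM('a))) * (\<Prod>i\<in>I. emeasure lborel ((\<lambda>x. s *\<^sub>R x) -` A i)) = (\<Prod>i\<in>I. emeasure lborel (A i))"
      unfolding prod.distrib[symmetric] using assms A
      by (intro prod.cong refl emeasure_lborel_scale[symmetric]) auto
    finally show "emeasure (scale_measure ?c (distr ?L ?L (\<lambda>p. \<lambda>i\<in>I. s *\<^sub>R p i))) (\<Pi>\<^sub>E i\<in>I. A i)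
        = (\<Prod>i\<in>I. emeasure lborel (A i))" .
  qed (use assms in auto)
  then have "emeasure ?L A = emeasure (scale_measure ?c (distr ?L ?L (\<lambda>p. \<lambda>i\<in>I. s *\<^sub>R p i))) A" by simp
  also have "\<dots> = ?c * emeasure ?L ((\<lambda>p. \<lambda>i\<in>I. s *\<^sub>R p i) -` A \<inter> space ?L)"
    using assms by (simp add: emeasure_distr[OF t])
  finally show ?thesis .
qed

definition kinetic :: "nat \<Rightarrow> (nat \<Rightarrow> 'a::euclidean_space) \<Rightarrow> real" where
  "kinetic N p = (\<Sum>i\<in>{1..N}. (norm (p i))\<^sup>2 / 2)"

definition momenta :: "nat \<Rightarrow> (nat \<Rightarrow> 'a::euclidean_space) measure" where
  "momenta N = (\<Pi>\<^sub>M i\<in>{1..N}. lborel)"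

lemma measurable_kinetic[measurable]: "kinetic N \<in> borel_measurable (momenta N)"
  unfolding kinetic_def momenta_def by measurable

lemma kinetic_nonneg: "0 \<le> kinetic N p"
  unfolding kinetic_def by (intro sum_nonneg) auto

text \<open>Kinetic energy is homogeneous of degree two, so dilation by \<open>sqrt t\<close>
  carries the unit set to this one.\<close>

lemma emeasure_kinetic_less:
  assumes "0 < t"
  shows "emeasure (momenta N) {p \<in> space (momenta N). kinetic N (p :: nat \<Rightarrow> 'a::euclidean_space) < t}
    = ennreal (t powr (real (DIM('a) * N) / 2)) * emeasure (momenta N) {p \<in> space (momenta N). kinetic N (p :: nat \<Rightarrow> 'a) < 1}"
proof -
  let ?A = "{p \<in> space (momenta N). kinetic N (p :: nat \<Rightarrow> 'a) < t}"
  have "?A \<in> sets (momenta N)" by measurable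
  then have "emeasure (momenta N) ?A = ennreal (sqrt t ^ (DIM('a) * N)) *
      emeasure (momenta N) ((\<lambda>p. \<lambda>i\<in>{1..N}. sqrt t *\<^sub>R p i) -` ?A \<inter> space (momenta N))"
    using emeasure_PiM_lborel_scale[of "sqrt t" "{1..N}" ?A] assms by (simp add: momenta_def)
  also have "(\<lambda>p. \<lambda>i\<in>{1..N}. sqrt t *\<^sub>R p i) -` ?A \<inter> space (momenta N)
      = {p \<in> space (momenta N). kinetic N (p :: nat \<Rightarrow> 'a) < 1}"
  proof -
    have "kinetic N (\<lambda>i\<in>{1..N}. sqrt t *\<^sub>R p i) = t * kinetic N p" for p :: "nat \<Rightarrow> 'a"
      using assms by (simp add: kinetic_def sum_distrib_left power_mult_distrib)
    then show ?thesis using assms by (auto simp: momenta_def space_PiM)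
  qed
  also have "sqrt t ^ (DIM('a) * N) = t powr (real (DIM('a) * N) / 2)"
    using assms by (simp add: powr_half_sqrt[symmetric] powr_powr flip: powr_realpow)
  finally show ?thesis .
qed

text \<open>The half-line is open so that exchanging integrals yields the strict sublevel sets
  \<open>kinetic N p < t\<close>; its endpoint is a null set.\<close>

lemma exp_minus_layer_cake:
  "ennreal (exp (- x)) = (\<integral>\<^sup>+ t. ennreal (exp (- t)) * indicator {x<..} t \<partial>lborel)" for x :: real
proof -
  have "((\<lambda>t. exp (- 1 * t)) has_integral exp (- 1 * x) / 1) {x..}"
    by (rule has_integral_exp_minus_to_infinity) simp
  from nn_integral_has_integral_lebesgue[OF _ this]
  have "ennreal (exp (- x)) = (\<integral>\<^sup>+ t. ennreal (indicator {x..} t * exp (- t)) \<partial>lborel)" by simp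
  also have "\<dots> = (\<integral>\<^sup>+ t. ennreal (exp (- t)) * indicator {x<..} t \<partial>lborel)"
    using AE_lborel_singleton[of x]
    by (intro nn_integral_cong_AE) (auto simp: indicator_def elim!: eventually_mono)
  finally show ?thesis .
qed

text \<open>Equal to (2 pi)^(d/2) in dimension d. Only its finiteness and positivity enter, since it
  contributes an additive constant to the entropy per particle.\<close>

definition gauss_mass :: "'a::euclidean_space itself \<Rightarrow> ennreal" where
  "gauss_mass _ = (\<integral>\<^sup>+ x. ennreal (exp (- (norm (x :: 'a))\<^sup>2 / 2)) \<partial>lborel)"

text \<open>The Gaussian integral over all momenta is evaluated twice: as a product over particles,
  and by layers of kinetic energy. In the second form the volume of the layer set is a multiple of
  \<open>t powr a\<close>, and integration against \<open>exp (- t)\<close> gives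
  \<open>Gamma (a + 1)\<close>. This determines the volume of the unit kinetic-energy set.\<close>

lemma gauss_mass_power:
  assumes "1 \<le> N"
  shows "gauss_mass TYPE('a::euclidean_space) ^ N
    = emeasure (momenta N) {p \<in> space (momenta N). kinetic N (p :: nat \<Rightarrow> 'a) < 1}
      * ennreal (Gamma (real (DIM('a) * N) / 2 + 1))"
proof -
  interpret P: product_sigma_finite "\<lambda>_::nat. lborel :: 'a measure" by unfold_locales
  interpret F: finite_product_sigma_finite "\<lambda>_::nat. lborel :: 'a measure" "{1..N}" by standard simp
  let ?M = "momenta N :: (nat \<Rightarrow> 'a) measure"
  interpret M: sigma_finite_measure ?M unfolding momenta_def by (rule F.sigma_finite_measure_axioms)
  interpret MT: pair_sigma_finite ?M "lborel :: real measure" by unfold_locales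
  let ?a = "real (DIM('a) * N) / 2"
  let ?K = "emeasure ?M {p \<in> space ?M. kinetic N p < 1}"
  have "gauss_mass TYPE('a) ^ N = (\<Prod>i\<in>{1..N}. \<integral>\<^sup>+ x. ennreal (exp (- (norm (x :: 'a))\<^sup>2 / 2)) \<partial>lborel)"
    by (simp add: gauss_mass_def)
  also have "\<dots> = (\<integral>\<^sup>+ p. (\<Prod>i\<in>{1..N}. ennreal (exp (- (norm (p i))\<^sup>2 / 2))) \<partial>?M)"
    unfolding momenta_def by (intro P.product_nn_integral_prod[symmetric]) auto
  also have "\<dots> = (\<integral>\<^sup>+ p. ennreal (exp (- kinetic N p)) \<partial>?M)"
    by (simp add: kinetic_def prod_ennreal exp_sum sum_negf[symmetric])
  also have "\<dots> = (\<integral>\<^sup>+ p. \<integral>\<^sup>+ t. ennreal (exp (- t)) * indicator {kinetic N p<..} t \<partial>lborel \<partial>?M)"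
    by (intro nn_integral_cong exp_minus_layer_cake)
  also have "\<dots> = (\<integral>\<^sup>+ t. \<integral>\<^sup>+ p. ennreal (exp (- t)) * indicator {kinetic N p<..} t \<partial>?M \<partial>lborel)"
  proof (rule MT.Fubini'[symmetric])
    have "(\<lambda>(p, t). ennreal (exp (- t)) * indicator {z \<in> space (?M \<Otimes>\<^sub>M lborel). kinetic N (fst z) < snd z} (p, t))
        \<in> borel_measurable (?M \<Otimes>\<^sub>M lborel)"
      by measurable
    also have "?this \<longleftrightarrow> (\<lambda>(p, t). ennreal (exp (- t)) * indicator {kinetic N p<..} t) \<in> borel_measurable (?M \<Otimes>\<^sub>M lborel)"
      by (intro measurable_cong) (auto simp: space_pair_measure indicator_def)
    finally show "(\<lambda>(p, t). ennreal (exp (- t)) * indicator {kinetic N p<..} t) \<in> borel_measurable (?M \<Otimes>\<^sub>M lborel)" .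
  qed
  also have "\<dots> = (\<integral>\<^sup>+ t. ?K * ennreal (indicator {0..} t * t powr (?a + 1 - 1) / exp t) \<partial>lborel)"
  proof (rule nn_integral_cong)
    fix t :: real
    have "(\<integral>\<^sup>+ p. ennreal (exp (- t)) * indicator {kinetic N p<..} t \<partial>?M)
        = (\<integral>\<^sup>+ p. ennreal (exp (- t)) * indicator {p \<in> space ?M. kinetic N p < t} p \<partial>?M)"
      by (intro nn_integral_cong) (auto simp: indicator_def)
    also have "\<dots> = ennreal (exp (- t)) * emeasure ?M {p \<in> space ?M. kinetic N p < t}"
      by (simp add: nn_integral_cmult)
    also have "\<dots> = ?K * ennreal (indicator {0..} t * t powr (?a + 1 - 1) / exp t)"
    proof (cases "0 < t")
      case True
      then have "exp (- t) * t powr ?a = indicator {0..} t * t powr (?a + 1 - 1) / exp t"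
        by (simp add: exp_minus field_simps)
      moreover have "ennreal (exp (- t)) * (ennreal (t powr ?a) * ?K) = ?K * ennreal (exp (- t) * t powr ?a)"
        by (simp add: ennreal_mult mult_ac)
      ultimately show ?thesis
        using emeasure_kinetic_less[OF True, of N, where 'a = 'a] by (simp only:)
    next
      case False
      then have empty: "{p \<in> space ?M. kinetic N p < t} = {}"
        using kinetic_nonneg by (auto simp: not_less intro: order.trans)
      show ?thesis unfolding empty using False by (simp add: indicator_def)
    qed
    finally show "(\<integral>\<^sup>+ p. ennreal (exp (- t)) * indicator {kinetic N p<..} t \<partial>?M)
        = ?K * ennreal (indicator {0..} t * t powr (?a + 1 - 1) / exp t)" .
  qed
  also have "\<dots> = ?K * (\<integral>\<^sup>+ t. ennreal (indicator {0..} t * t powr (?a + 1 - 1) / exp t) \<partial>lborel)"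
    by (rule nn_integral_cmult) measurable
  also have "(\<integral>\<^sup>+ t. ennreal (indicator {0..} t * t powr (?a + 1 - 1) / exp t) \<partial>lborel) = ennreal (Gamma (?a + 1))"
    by (rule Gamma_conv_nn_integral_real[symmetric], rule add_nonneg_pos) auto
  finally show ?thesis .
qed

text \<open>For \<open>N = 1\<close> the unit kinetic-energy set is a ball of radius
  \<open>sqrt 2\<close>, and \<open>gauss_mass_power\<close> transfers its finite nonzero volume to
  the Gaussian integral.\<close>

lemma gauss_mass_finite: "gauss_mass TYPE('a::euclidean_space) \<noteq> \<infinity>"
  and gauss_mass_nonzero: "gauss_mass TYPE('a::euclidean_space) \<noteq> 0"
proof -
  interpret P: product_sigma_finite "\<lambda>_::nat. lborel :: 'a measure" by unfold_locales
  have "{p \<in> space (momenta 1). kinetic 1 (p :: nat \<Rightarrow> 'a) < 1} = (\<Pi>\<^sub>E i\<in>{1}. ball 0 (sqrt 2))"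
  proof -
    have "(norm x)\<^sup>2 < 2 \<longleftrightarrow> norm x < sqrt 2" for x :: 'a
      using real_sqrt_less_iff[of "(norm x)\<^sup>2" 2] by simp
    then show ?thesis by (auto simp: momenta_def space_PiM kinetic_def PiE_iff extensional_def)
  qed
  then have K: "emeasure (momenta 1) {p \<in> space (momenta 1). kinetic 1 (p :: nat \<Rightarrow> 'a) < 1} = emeasure lborel (ball (0::'a) (sqrt 2))"
    by (simp add: momenta_def P.emeasure_PiM)
  have *: "gauss_mass TYPE('a) = emeasure lborel (ball (0::'a) (sqrt 2)) * ennreal (Gamma (real (DIM('a)) / 2 + 1))"
    using gauss_mass_power[of 1, where 'a = 'a] unfolding K by simp
  show "gauss_mass TYPE('a) \<noteq> \<infinity>"
    using emeasure_bounded_finite[of "ball (0::'a) (sqrt 2)"] unfolding *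
    by (auto simp: ennreal_mult_eq_top_iff)
  have "ennreal (Gamma (real (DIM('a)) / 2 + 1)) \<noteq> 0"
    by (simp add: ennreal_eq_0_iff not_le Gamma_real_pos)
  then show "gauss_mass TYPE('a) \<noteq> 0"
    using emeasure_lborel_open_nonzero[of "ball (0::'a) (sqrt 2)"] unfolding * by simp
qed

section \<open>Phase volume of a confined potential\<close>

context confined_potential
begin

definition volume :: real where "volume = measure lborel \<Lambda>"

lemma emeasure_\<Lambda>: "emeasure lborel \<Lambda> = ennreal volume"
  and volume_pos: "0 < volume"
proof -
  show *: "emeasure lborel \<Lambda> = ennreal volume"
    using volume_\<Lambda>(2) by (simp add: volume_def emeasure_eq_ennreal_measure)
  show "0 < volume" using volume_\<Lambda>(1) unfolding * by (auto simp: ennreal_eq_0_iff)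
qed

lemma configurations_eq_density:
  assumes "finite I"
  shows "configurations I = density (\<Pi>\<^sub>M i\<in>I. lborel)
    (\<lambda>q. ennreal (1 / volume ^ card I) * indicator (\<Pi>\<^sub>E i\<in>I. \<Lambda>) q)"
proof -
  interpret P: prob_space uniform_position by (rule prob_space_P)
  interpret PS: product_sigma_finite "\<lambda>_::nat. uniform_position" by unfold_locales
  interpret L: product_sigma_finite "\<lambda>_::nat. lborel :: 'a measure" by unfold_locales
  let ?L = "\<Pi>\<^sub>M i\<in>I. (lborel :: 'a measure)" and ?c = "ennreal (1 / volume ^ card I)"
  have S: "(\<Pi>\<^sub>E i\<in>I. \<Lambda>) \<in> sets ?L" using assms by (intro sets_PiM_I_finite) auto
  then have m: "(\<lambda>q. ?c * indicator (\<Pi>\<^sub>E i\<in>I. \<Lambda>) q) \<in> borel_measurable ?L" by measurable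
  show ?thesis
    unfolding configurations_def
  proof (rule PS.PiM_eqI[symmetric])
    show "sets (density ?L (\<lambda>q. ?c * indicator (\<Pi>\<^sub>E i\<in>I. \<Lambda>) q)) = sets (\<Pi>\<^sub>M i\<in>I. uniform_position)"
      by (simp, intro sets_PiM_cong) auto
    fix A :: "nat \<Rightarrow> 'a set" assume "\<And>i. i \<in> I \<Longrightarrow> A i \<in> sets uniform_position"
    then have A: "\<And>i. i \<in> I \<Longrightarrow> A i \<in> sets lborel" by simp
    then have SA: "(\<Pi>\<^sub>E i\<in>I. A i) \<in> sets ?L" using assms by (intro sets_PiM_I_finite) auto
    have "emeasure (density ?L (\<lambda>q. ?c * indicator (\<Pi>\<^sub>E i\<in>I. \<Lambda>) q)) (\<Pi>\<^sub>E i\<in>I. A i)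
        = (\<integral>\<^sup>+ q. ?c * indicator (\<Pi>\<^sub>E i\<in>I. \<Lambda>) q * indicator (\<Pi>\<^sub>E i\<in>I. A i) q \<partial>?L)"
      by (rule emeasure_density[OF m SA])
    also have "\<dots> = (\<integral>\<^sup>+ q. ?c * indicator (\<Pi>\<^sub>E i\<in>I. \<Lambda> \<inter> A i) q \<partial>?L)"
      by (intro nn_integral_cong) (auto simp: indicator_def PiE_iff)
    also have "\<dots> = ?c * emeasure ?L (\<Pi>\<^sub>E i\<in>I. \<Lambda> \<inter> A i)"
      using A assms by (intro nn_integral_cmult_indicator sets_PiM_I_finite) auto
    also have "\<dots> = ?c * (\<Prod>i\<in>I. emeasure lborel (\<Lambda> \<inter> A i))"
      using A assms by (subst L.emeasure_PiM) auto
    also have "\<dots> = (\<Prod>i\<in>I. ennreal (1 / volume)) * (\<Prod>i\<in>I. emeasure lborel (\<Lambda> \<inter> A i))"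
      using volume_pos by (simp add: ennreal_power power_divide)
    also have "(\<Prod>i\<in>I. ennreal (1 / volume)) * (\<Prod>i\<in>I. emeasure lborel (\<Lambda> \<inter> A i))
        = (\<Prod>i\<in>I. emeasure uniform_position (A i))"
      unfolding prod.distrib[symmetric]
    proof (rule prod.cong[OF refl])
      fix i assume "i \<in> I"
      then have "A i \<in> sets lborel" by (rule A)
      then have "emeasure uniform_position (A i) = emeasure lborel (\<Lambda> \<inter> A i) / emeasure lborel \<Lambda>"
        unfolding uniform_position_def by (intro emeasure_uniform_measure) auto
      then show "ennreal (1 / volume) * emeasure lborel (\<Lambda> \<inter> A i) = emeasure uniform_position (A i)"
        using volume_pos by (simp add: emeasure_\<Lambda> divide_ennreal_def inverse_ennreal mult.commute inverse_eq_divide)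
    qed
    finally show "emeasure (density ?L (\<lambda>q. ?c * indicator (\<Pi>\<^sub>E i\<in>I. \<Lambda>) q)) (\<Pi>\<^sub>E i\<in>I. A i)
        = (\<Prod>i\<in>I. emeasure uniform_position (A i))" .
  qed (use assms in auto)
qed

lemma sets_configurations: "sets (configurations I) = sets (\<Pi>\<^sub>M i\<in>I. lborel)"
  unfolding configurations_def by (intro sets_PiM_cong) auto

lemma nn_integral_positions:
  assumes "finite I" "h \<in> borel_measurable (configurations I)"
  shows "(\<integral>\<^sup>+ q. h q * indicator (\<Pi>\<^sub>E i\<in>I. \<Lambda>) q \<partial>(\<Pi>\<^sub>M i\<in>I. lborel))
    = ennreal (volume ^ card I) * (\<integral>\<^sup>+ q. h q \<partial>configurations I)"
proof -
  let ?L = "\<Pi>\<^sub>M i\<in>I. (lborel :: 'a measure)" and ?c = "ennreal (1 / volume ^ card I)"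
  have S: "(\<Pi>\<^sub>E i\<in>I. \<Lambda>) \<in> sets ?L" using assms by (intro sets_PiM_I_finite) auto
  have h: "h \<in> borel_measurable ?L"
    using assms(2) unfolding measurable_cong_sets[OF sets_configurations refl] .
  have "(\<integral>\<^sup>+ q. h q \<partial>configurations I) = (\<integral>\<^sup>+ q. ?c * indicator (\<Pi>\<^sub>E i\<in>I. \<Lambda>) q * h q \<partial>?L)"
    unfolding configurations_eq_density[OF assms(1)] using S h
    by (intro nn_integral_density borel_measurable_times_ennreal borel_measurable_indicator borel_measurable_const)
  also have "\<dots> = (\<integral>\<^sup>+ q. ?c * (h q * indicator (\<Pi>\<^sub>E i\<in>I. \<Lambda>) q) \<partial>?L)"
    by (intro nn_integral_cong) (simp add: mult_ac)
  also have "\<dots> = ?c * (\<integral>\<^sup>+ q. h q * indicator (\<Pi>\<^sub>E i\<in>I. \<Lambda>) q \<partial>?L)"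
    using S h by (intro nn_integral_cmult borel_measurable_times_ennreal borel_measurable_indicator)
  finally have "ennreal (volume ^ card I) * (\<integral>\<^sup>+ q. h q \<partial>configurations I)
      = ennreal (volume ^ card I) * ?c * (\<integral>\<^sup>+ q. h q * indicator (\<Pi>\<^sub>E i\<in>I. \<Lambda>) q \<partial>?L)"
    by (simp add: mult.assoc)
  also have "ennreal (volume ^ card I) * ?c = 1"
    using volume_pos by (subst ennreal_mult[symmetric]) auto
  finally show ?thesis by simp
qed

text \<open>The sublevel set behind \<open>phase_volume\<close> in real-valued form, available
  because the potential is finite once all positions lie in \<Lambda>.\<close>

definition phase_points :: "nat \<Rightarrow> real \<Rightarrow> (nat \<Rightarrow> 'a \<times> 'a) set" where
  "phase_points N e = {X \<in> space (\<Pi>\<^sub>M i\<in>{1..N}. lborel). (\<forall>i\<in>{1..N}. snd (X i) \<in> \<Lambda>) \<and>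
    real N * kinetic N (\<lambda>i. fst (X i)) + (real N)\<^sup>2 * energy N (\<lambda>i. snd (X i)) < e}"

lemma sets_phase_points: "phase_points N e \<in> sets (\<Pi>\<^sub>M i\<in>{1..N}. (lborel \<Otimes>\<^sub>M lborel))"
proof -
  let ?M = "\<Pi>\<^sub>M i\<in>{1..N}. (lborel \<Otimes>\<^sub>M (lborel :: 'a measure))"
  have [measurable]: "(\<lambda>X. snd (X i)) \<in> ?M \<rightarrow>\<^sub>M lborel" "(\<lambda>X. fst (X i)) \<in> ?M \<rightarrow>\<^sub>M lborel" if "i \<in> {1..N}" for i
    using that by measurable
  have pe[measurable]: "(\<lambda>X. pair_energy (snd (X i)) (snd (X j))) \<in> borel_measurable ?M" if "i \<in> {1..N}" "j \<in> {i<..N}" for i j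
  proof -
    have "(\<lambda>X. snd (X k)) \<in> ?M \<rightarrow>\<^sub>M uniform_position" if "k \<in> {1..N}" for k
      using that unfolding measurable_cong_sets[OF refl sets_uniform_position] by measurable
    then have "(\<lambda>X. (snd (X i), snd (X j))) \<in> ?M \<rightarrow>\<^sub>M uniform_position \<Otimes>\<^sub>M uniform_position"
      using that by (intro measurable_Pair) auto
    from measurable_compose[OF this measurable_u] show ?thesis by simp
  qed
  have [measurable]: "(\<lambda>X. energy N (\<lambda>i. snd (X i))) \<in> borel_measurable ?M"
    unfolding energy_def by (intro borel_measurable_divide borel_measurable_sum pe) auto
  have [measurable]: "(\<lambda>X. kinetic N (\<lambda>i. fst (X i))) \<in> borel_measurable ?M"
    unfolding kinetic_def by measurable
  show ?thesis unfolding phase_points_def lborel_prod[symmetric] by measurable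
qed

text \<open>Slicing at fixed positions leaves a kinetic-energy ball in the momenta; its volume,
  integrated over the positions, is the truncated moment.\<close>

lemma emeasure_phase_points:
  assumes N: "1 \<le> N"
  defines "a \<equiv> real (DIM('a) * N) / 2"
  shows "emeasure (\<Pi>\<^sub>M i\<in>{1..N}. lborel) (phase_points N e)
    = ennreal (volume ^ N * real N powr a * truncated_moment (configurations {1..N}) (energy N) a (e / (real N)\<^sup>2))
      * emeasure (momenta N) {p \<in> space (momenta N). kinetic N (p :: nat \<Rightarrow> 'a) < 1}"
proof -
  interpret L: product_sigma_finite "\<lambda>_::nat. lborel :: 'a measure" by unfold_locales
  interpret F: finite_product_sigma_finite "\<lambda>_::nat. lborel :: 'a measure" "{1..N}" by standard simp
  interpret V: nonneg_variable "configurations {1..N}" "energy N" by (rule nonneg_variable_energy)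
  let ?M = "momenta N :: (nat \<Rightarrow> 'a) measure" and ?L = "\<Pi>\<^sub>M i\<in>{1..N}. (lborel :: 'a measure)"
  let ?LL = "\<Pi>\<^sub>M i\<in>{1..N}. (lborel \<Otimes>\<^sub>M (lborel :: 'a measure))"
  let ?t = "\<lambda>(p, q). \<lambda>i\<in>{1..N}. (p i, q i) :: 'a \<times> 'a"
  let ?K = "emeasure ?M {p \<in> space ?M. kinetic N p < 1}"
  let ?\<Lambda> = "\<Pi>\<^sub>E i\<in>{1..N}. \<Lambda>"
  define h where "h q = max 0 (e / (real N)\<^sup>2 - energy N q) powr a" for q
  have a: "0 < a" using N by (simp add: a_def)
  have hm: "(\<lambda>q. ennreal (h q)) \<in> borel_measurable (configurations {1..N})" unfolding h_def by measurable
  interpret M: sigma_finite_measure ?M unfolding momenta_def by (rule F.sigma_finite_measure_axioms)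
  interpret MM: pair_sigma_finite ?M ?L
    by (intro pair_sigma_finite.intro M.sigma_finite_measure_axioms F.sigma_finite_measure_axioms)
  have t: "?t \<in> ?M \<Otimes>\<^sub>M ?L \<rightarrow>\<^sub>M ?LL" unfolding momenta_def by measurable
  have D: "phase_points N e \<in> sets ?LL" by (rule sets_phase_points)
  have "distr (?M \<Otimes>\<^sub>M ?L) ?LL ?t = ?LL"
    unfolding momenta_def by (intro distr_PiM_pair_measure) (auto intro: lborel.sigma_finite_measure_axioms)
  then have "emeasure ?LL (phase_points N e) = emeasure (distr (?M \<Otimes>\<^sub>M ?L) ?LL ?t) (phase_points N e)" by simp
  also have "\<dots> = emeasure (?M \<Otimes>\<^sub>M ?L) (?t -` phase_points N e \<inter> space (?M \<Otimes>\<^sub>M ?L))"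
    by (rule emeasure_distr[OF t D])
  also have "\<dots> = (\<integral>\<^sup>+ q. emeasure ?M ((\<lambda>p. (p, q)) -` (?t -` phase_points N e \<inter> space (?M \<Otimes>\<^sub>M ?L))) \<partial>?L)"
    by (rule MM.emeasure_pair_measure_alt2[OF measurable_sets[OF t D]])
  also have "\<dots> = (\<integral>\<^sup>+ q. ?K * ennreal (real N powr a) * ennreal (h q) * indicator ?\<Lambda> q \<partial>?L)"
  proof (rule nn_integral_cong)
    fix q assume q: "q \<in> space ?L"
    \<comment> \<open>The kinetic energy left at positions \<open>q\<close>, after division by the
      factor \<open>N\<close> of the Hamiltonian. Measuring energies in units of
      \<open>N\<^sup>2\<close> then leaves a factor \<open>N\<close>, whence
      \<open>real N powr a\<close>.\<close>
    define s where "s = (e - (real N)\<^sup>2 * energy N q) / real N"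
    have "energy N (\<lambda>i. snd (?t (p, q) i)) = energy N q" for p
      unfolding energy_def by (intro arg_cong2[where f = "(/)"] sum.cong) auto
    moreover have "kinetic N (\<lambda>i. fst (?t (p, q) i)) = kinetic N p" for p
      unfolding kinetic_def by (intro sum.cong) auto
    moreover have "real N * k + (real N)\<^sup>2 * energy N q < e \<longleftrightarrow> k < s" for k
      using N by (simp add: s_def field_simps)
    ultimately have sec: "(\<lambda>p. (p, q)) -` (?t -` phase_points N e \<inter> space (?M \<Otimes>\<^sub>M ?L))
        = (if q \<in> ?\<Lambda> then {p \<in> space ?M. kinetic N p < s} else {})"
      using q by (auto simp: phase_points_def space_pair_measure space_PiM momenta_def PiE_iff extensional_def)
    have "emeasure ?M {p \<in> space ?M. kinetic N p < s} = ?K * ennreal (max 0 s powr a)"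
    proof (cases "0 < s")
      case True
      then show ?thesis using emeasure_kinetic_less[OF True, of N, where 'a = 'a] by (simp add: a_def mult.commute)
    next
      case False
      then have empty: "{p \<in> space ?M. kinetic N p < s} = {}"
        using kinetic_nonneg by (auto simp: not_less intro: order.trans)
      show ?thesis unfolding empty using False by (simp add: max_def)
    qed
    also have "max 0 s = real N * max 0 (e / (real N)\<^sup>2 - energy N q)"
    proof -
      have "s = real N * (e / (real N)\<^sup>2 - energy N q)"
        using N by (simp add: s_def field_simps power2_eq_square)
      then show ?thesis using N by (simp add: max_def mult_le_0_iff zero_le_mult_iff)
    qed
    also have "(real N * max 0 (e / (real N)\<^sup>2 - energy N q)) powr a = real N powr a * h q"
      unfolding h_def by (rule powr_mult)
    finally have "emeasure ?M {p \<in> space ?M. kinetic N p < s} = ?K * ennreal (real N powr a) * ennreal (h q)"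
      by (simp add: ennreal_mult h_def mult.assoc)
    then show "emeasure ?M ((\<lambda>p. (p, q)) -` (?t -` phase_points N e \<inter> space (?M \<Otimes>\<^sub>M ?L)))
        = ?K * ennreal (real N powr a) * ennreal (h q) * indicator ?\<Lambda> q"
      unfolding sec by simp
  qed
  also have "\<dots> = ennreal (volume ^ N) * (\<integral>\<^sup>+ q. ?K * ennreal (real N powr a) * ennreal (h q) \<partial>configurations {1..N})"
  proof -
    have "(\<lambda>q. ?K * ennreal (real N powr a) * ennreal (h q)) \<in> borel_measurable (configurations {1..N})"
      by (intro borel_measurable_times_ennreal borel_measurable_const hm)
    from nn_integral_positions[OF finite_atLeastAtMost this] show ?thesis
      by (simp only: card_atLeastAtMost diff_Suc_1)
  qed
  also have "(\<integral>\<^sup>+ q. ?K * ennreal (real N powr a) * ennreal (h q) \<partial>configurations {1..N})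
      = ?K * ennreal (real N powr a) * (\<integral>\<^sup>+ q. ennreal (h q) \<partial>configurations {1..N})"
    by (rule nn_integral_cmult[OF hm])
  also have "(\<integral>\<^sup>+ q. ennreal (h q) \<partial>configurations {1..N})
      = ennreal (truncated_moment (configurations {1..N}) (energy N) a (e / (real N)\<^sup>2))"
    unfolding truncated_moment_def h_def using a
    by (intro nn_integral_eq_integral V.integrable_truncated_power) auto
  also have "ennreal (volume ^ N) * (?K * ennreal (real N powr a) *
        ennreal (truncated_moment (configurations {1..N}) (energy N) a (e / (real N)\<^sup>2)))
      = ennreal (volume ^ N * real N powr a * truncated_moment (configurations {1..N}) (energy N) a (e / (real N)\<^sup>2)) * ?K"
    using volume_pos V.truncated_moment_nonneg by (simp add: ennreal_mult mult.assoc mult.commute[of ?K])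
  finally show ?thesis unfolding lborel_prod .
qed

end

context confined_potential
begin

definition gauss :: real where "gauss = enn2real (gauss_mass TYPE('a))"

lemma gauss_mass_eq: "gauss_mass TYPE('a) = ennreal gauss"
  and gauss_pos: "0 < gauss"
proof -
  show *: "gauss_mass TYPE('a) = ennreal gauss"
    using gauss_mass_finite[where 'a = 'a] by (simp add: gauss_def ennreal_enn2real_if)
  show "0 < gauss" using gauss_mass_nonzero[where 'a = 'a] unfolding * by (auto simp: ennreal_eq_0_iff)
qed

text \<open>By \<open>gauss_mass_power\<close>, \<open>gauss ^ N\<close> over the Gamma value is the
  volume of the unit kinetic-energy set; \<open>volume ^ N\<close> undoes the normalisation of the
  uniform positions, and the power of \<open>N\<close> comes from rescaling energies.\<close>

definition phase_const :: "nat \<Rightarrow> real" where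
  "phase_const N = (volume * gauss) ^ N * real N powr (real (DIM('a) * N) / 2)
    / (Gamma (real (DIM('a) * N) / 2 + 1) * fact N)"

lemma Gamma_dim_pos: "0 < Gamma (real (DIM('a) * N) / 2 + 1)"
  by (rule Gamma_real_pos, rule add_nonneg_pos) auto

lemma phase_const_pos: "1 \<le> N \<Longrightarrow> 0 < phase_const N"
  unfolding phase_const_def using volume_pos gauss_pos Gamma_dim_pos[of N]
  by (intro divide_pos_pos mult_pos_pos zero_less_power) auto

lemma measure_phase_points:
  assumes N: "1 \<le> N"
  shows "1 / fact N * measure (\<Pi>\<^sub>M i\<in>{1..N}. lborel) (phase_points N e)
    = phase_const N * truncated_moment (configurations {1..N}) (energy N) (real (DIM('a) * N) / 2) (e / (real N)\<^sup>2)"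
proof -
  interpret V: nonneg_variable "configurations {1..N}" "energy N" by (rule nonneg_variable_energy)
  let ?K = "emeasure (momenta N) {p \<in> space (momenta N). kinetic N (p :: nat \<Rightarrow> 'a) < 1}"
  let ?a = "real (DIM('a) * N) / 2"
  let ?G = "Gamma (?a + 1)"
  let ?J = "truncated_moment (configurations {1..N}) (energy N) ?a (e / (real N)\<^sup>2)"
  have G: "0 < ?G" by (rule Gamma_dim_pos)
  have "?K = ?K * ennreal (?G * (1 / ?G))" using G by simp
  also have "\<dots> = ?K * ennreal ?G * ennreal (1 / ?G)" using G by (simp only: ennreal_mult' less_imp_le mult.assoc)
  also have "?K * ennreal ?G = ennreal (gauss ^ N)"
    using gauss_mass_power[OF N, where 'a = 'a] gauss_pos unfolding gauss_mass_eq by (simp add: ennreal_power)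
  also have "ennreal (gauss ^ N) * ennreal (1 / ?G) = ennreal (gauss ^ N / ?G)"
    using G gauss_pos by (subst ennreal_mult[symmetric]) auto
  finally have K: "?K = ennreal (gauss ^ N / ?G)" .
  have "emeasure (\<Pi>\<^sub>M i\<in>{1..N}. lborel) (phase_points N e)
      = ennreal (volume ^ N * real N powr ?a * ?J) * ennreal (gauss ^ N / ?G)"
    using emeasure_phase_points[OF N, of e] unfolding K .
  also have "\<dots> = ennreal (volume ^ N * real N powr ?a * ?J * (gauss ^ N / ?G))"
    using G gauss_pos volume_pos V.truncated_moment_nonneg by (intro ennreal_mult[symmetric]) auto
  finally have "measure (\<Pi>\<^sub>M i\<in>{1..N}. lborel) (phase_points N e) = volume ^ N * real N powr ?a * ?J * (gauss ^ N / ?G)"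
    using G gauss_pos volume_pos V.truncated_moment_nonneg by (simp add: measure_def)
  then show ?thesis
    by (simp add: phase_const_def power_mult_distrib mult_ac)
qed

end

section \<open>From the Hamiltonian to moments, and the entropy expansion\<close>

lemma phase_volume_eq:
  fixes \<Lambda> :: "(real^3) set"
  assumes "confined_potential \<Lambda> f" and U: "\<And>x y. x \<in> \<Lambda> \<Longrightarrow> y \<in> \<Lambda> \<Longrightarrow> U x y = ereal (f x y)" and N: "1 \<le> N"
  shows "phase_volume \<Lambda> U N e = confined_potential.phase_const \<Lambda> N *
    truncated_moment (mean_field.configurations (confined_potential.uniform_position \<Lambda>) {1..N})
      (mean_field.energy (confined_potential.pair_energy \<Lambda> f) N) (3 * real N / 2) (e / (real N)\<^sup>2)"
proof -
  interpret confined_potential \<Lambda> f by fact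
  let ?M = "\<Pi>\<^sub>M i\<in>{1..N}. (lborel :: ((real^3) \<times> (real^3)) measure)"
  have "hamiltonian U N X = ereal (real N * kinetic N (\<lambda>i. fst (X i)) + (real N)\<^sup>2 * energy N (\<lambda>i. snd (X i)))"
    if "\<And>i. i \<in> {1..N} \<Longrightarrow> snd (X i) \<in> \<Lambda>" for X
  proof -
    have "(\<Sum>i\<in>{1..N}. \<Sum>j\<in>{i<..N}. U (snd (X i)) (snd (X j)))
        = (\<Sum>i\<in>{1..N}. \<Sum>j\<in>{i<..N}. ereal (pair_energy (snd (X i)) (snd (X j))))"
      using that by (intro sum.cong refl) (auto simp: U pair_energy_def)
    also have "\<dots> = ereal ((real N)\<^sup>2 * energy N (\<lambda>i. snd (X i)))"
      using N by (simp add: energy_def)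
    finally show ?thesis by (simp add: hamiltonian_def kinetic_def)
  qed
  then have "X \<in> (\<Pi>\<^sub>E i\<in>{1..N}. UNIV \<times> \<Lambda>) \<and> hamiltonian U N X < ereal e \<longleftrightarrow> X \<in> phase_points N e" for X
    by (auto simp: phase_points_def space_PiM PiE_iff mem_Times_iff)
  then have ind: "indicator (\<Pi>\<^sub>E i\<in>{1..N}. UNIV \<times> \<Lambda>) X *\<^sub>R indicator {X. hamiltonian U N X < ereal e} X
      = (indicator (phase_points N e) X :: real)" for X
    by (auto simp: indicator_def)
  have "phase_volume \<Lambda> U N e = 1 / fact N * (LINT X|?M. indicator (phase_points N e) X)"
    unfolding phase_volume_def set_lebesgue_integral_def ind ..
  also have "(LINT X|?M. indicator (phase_points N e) X) = measure ?M (phase_points N e)"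
    using sets_phase_points[of N e] by (simp add: lborel_prod)
  finally show ?thesis
    using measure_phase_points[OF N, of e] by simp
qed

text \<open>In units of \<open>N * ln N\<close>, the power of \<open>N\<close> contributes
  \<open>3/2\<close>, the Gamma value \<open>- 3/2\<close> and the factorial \<open>- 1\<close>. The
  total \<open>- 1\<close> is the leading term of the entropy; the factor produced by
  differentiation adds only a multiple of \<open>ln N\<close> and a constant.\<close>

lemma ln_phase_const_asymp:
  fixes \<Lambda> :: "(real^3) set"
  assumes "confined_potential \<Lambda> f"
  shows "\<exists>c. (\<lambda>N. (ln (confined_potential.phase_const \<Lambda> N * (3 * real N / 2) / (real N)\<^sup>2)
    + real N * ln (real N)) / real N) \<longlonglongrightarrow> c"
proof -
  interpret confined_potential \<Lambda> f by fact
  define r where "r x = (ln (Gamma (x + 1)) - x * ln x + x) / x" for x :: real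
  \<comment> \<open>The \<open>5 / 2\<close> collects the linear Stirling terms,
    \<open>3 / 2\<close> from the Gamma value and \<open>1\<close> from the factorial;
    \<open>3 / 2 * ln (3 / 2)\<close> arises from \<open>ln (3N/2)\<close> in the former.\<close>
  define c where "c = ln (volume * gauss) + 5 / 2 - 3 / 2 * ln (3 / 2)"
  have r: "(r \<longlongrightarrow> 0) at_top" using ln_Gamma_asymp by (simp add: r_def[abs_def])
  have "(\<lambda>N. r (real N)) \<longlonglongrightarrow> 0" "(\<lambda>N. r (3 * real N / 2)) \<longlonglongrightarrow> 0"
    by (rule filterlim_compose[OF r], real_asymp)+
  moreover have "(\<lambda>N. (ln (3 / 2) - ln (real N)) / real N) \<longlonglongrightarrow> 0" by real_asymp
  ultimately have "(\<lambda>N. c - 3 / 2 * r (3 * real N / 2) - r (real N) + (ln (3 / 2) - ln (real N)) / real N)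
      \<longlonglongrightarrow> c - 3 / 2 * 0 - 0 + 0"
    by (intro tendsto_intros)
  then have lim: "(\<lambda>N. c - 3 / 2 * r (3 * real N / 2) - r (real N) + (ln (3 / 2) - ln (real N)) / real N) \<longlonglongrightarrow> c"
    by simp
  have "\<forall>\<^sub>F N in sequentially. c - 3 / 2 * r (3 * real N / 2) - r (real N) + (ln (3 / 2) - ln (real N)) / real N
      = (ln (phase_const N * (3 * real N / 2) / (real N)\<^sup>2) + real N * ln (real N)) / real N"
    using eventually_ge_at_top[of 1]
  proof eventually_elim
    case (elim N)
    have N: "0 < real N" using elim by simp
    let ?x = "3 * real N / 2"
    have G: "0 < Gamma (?x + 1)" using Gamma_dim_pos[of N] by simp
    have lnG: "ln (Gamma (x + 1)) = x * r x + x * ln x - x" if "0 < x" for x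
      using that by (simp add: r_def)
    have fact: "ln (fact N :: real) = real N * r (real N) + real N * ln (real N) - real N"
      using lnG[OF N] Gamma_fact[of N, where 'a = real] by (simp add: add.commute)
    have "ln (phase_const N * ?x / (real N)\<^sup>2) = real N * ln (volume * gauss) + ?x * ln (real N)
        - ln (Gamma (?x + 1)) - ln (fact N) + ln ?x - 2 * ln (real N)"
    proof -
      have split: "ln (v ^ N * real N powr y / (g * k)) = real N * ln v + y * ln (real N) - (ln g + ln k)"
        if "0 < v" "0 < g" "0 < k" for v y g k :: real
        using N that by (subst ln_div) (auto simp: ln_mult_pos ln_realpow ln_powr)
      have "phase_const N = (volume * gauss) ^ N * real N powr ?x / (Gamma (?x + 1) * fact N)"
        by (simp add: phase_const_def)
      moreover have "ln ((volume * gauss) ^ N * real N powr ?x / (Gamma (?x + 1) * fact N))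
          = real N * ln (volume * gauss) + ?x * ln (real N) - (ln (Gamma (?x + 1)) + ln (fact N))"
        by (intro split mult_pos_pos volume_pos gauss_pos G fact_gt_zero)
      moreover have "ln (phase_const N * ?x / (real N)\<^sup>2) = ln (phase_const N) + ln ?x - 2 * ln (real N)"
        using N phase_const_pos[OF elim] by (simp add: ln_div ln_mult_pos ln_realpow)
      ultimately show ?thesis by simp
    qed
    also have "\<dots> = real N * ln (volume * gauss) + ?x * ln (real N)
        - (?x * r ?x + ?x * ln ?x - ?x) - (real N * r (real N) + real N * ln (real N) - real N) + ln ?x - 2 * ln (real N)"
      using N by (simp add: fact lnG[of ?x])
    also have "ln ?x = ln (3 / 2) + ln (real N)"
      using N ln_mult_pos[of "3 / 2" "real N"] by simp
    finally have "ln (phase_const N * ?x / (real N)\<^sup>2) + real N * ln (real N)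
        = real N * (c - 3 / 2 * r ?x - r (real N)) + (ln (3 / 2) - ln (real N))"
      by (simp add: c_def algebra_simps add_divide_distrib)
    then show ?case using N by (simp add: add_divide_distrib)
  qed
  from Lim_transform_eventually[OF lim this] show ?thesis by blast
qed

lemma ground_energy_nonneg: "0 \<le> ground_energy \<Lambda> U"
  unfolding ground_energy_def by (intro INF_greatest) simp

lemma prob_measures_on_empty: "prob_measures_on {} = {}"
proof -
  have False if "prob_space \<mu>" "sets \<mu> = sets (restrict_space borel {})" for \<mu> :: "(real^3) measure"
  proof -
    have "space \<mu> = {}" using sets_eq_imp_space_eq[OF that(2)] by (simp add: space_restrict_space)
    with prob_space.not_empty[OF that(1)] show False by contradiction
  qed
  then show ?thesis by (auto simp: prob_measures_on_def)
qed

theorem theorem1: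
  fixes \<Lambda> :: "(real^3) set" and U :: "real^3 \<Rightarrow> real^3 \<Rightarrow> ereal"
  assumes "bounded \<Lambda>" and "connected \<Lambda>" and "open \<Lambda>"
    and U_nonneg: "\<And>x y. 0 \<le> U x y"
    and U_sym: "\<And>x y. U x y = U y x"
    and U_finite: "\<And>x y. x \<in> closure \<Lambda> \<Longrightarrow> y \<in> closure \<Lambda> \<Longrightarrow> U x y < \<infinity>"
    and U_cont: "continuous_on (closure \<Lambda> \<times> closure \<Lambda>) (\<lambda>(x, y). U x y)"
    and U_outside: "\<And>x y. x \<notin> closure \<Lambda> \<or> y \<notin> closure \<Lambda> \<Longrightarrow> U x y = \<infinity>"
  shows "\<exists>s :: real \<Rightarrow> real.
    (\<forall>\<epsilon>. ground_energy \<Lambda> U < ereal \<epsilon> \<longrightarrow>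
       (\<forall>N\<ge>1. phase_volume \<Lambda> U N differentiable at ((real N)\<^sup>2 * \<epsilon>) \<and>
              0 < deriv (phase_volume \<Lambda> U N) ((real N)\<^sup>2 * \<epsilon>)) \<and>
       (\<lambda>N. ergodic_entropy \<Lambda> U N ((real N)\<^sup>2 * \<epsilon>) - (- real N * ln (real N) + real N * s \<epsilon>))
         \<in> o(\<lambda>N. real N)) \<and>
    continuous_on {\<epsilon>. ground_energy \<Lambda> U < ereal \<epsilon>} s \<and>
    strict_mono_on {\<epsilon>. ground_energy \<Lambda> U < ereal \<epsilon>} s"
proof (cases "\<Lambda> = {}")
  case True
  \<comment> \<open>The empty domain carries no probability measure, so no \<epsilon> lies above the
    ground energy and every claim is vacuous.\<close>
  then have "ground_energy \<Lambda> U = \<infinity>" by (simp add: ground_energy_def prob_measures_on_empty top_ereal_def)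
  then show ?thesis by (simp add: strict_mono_on_def)
next
  case False
  define f where "f x y = real_of_ereal (U x y)" for x y
  have U_eq: "U x y = ereal (f x y)" if "x \<in> closure \<Lambda>" "y \<in> closure \<Lambda>" for x y
    using U_finite[OF that] U_nonneg[of x y] by (cases "U x y") (auto simp: f_def)
  have cp: "confined_potential \<Lambda> f"
  proof
    have "continuous_on (closure \<Lambda> \<times> closure \<Lambda>) (\<lambda>z. ereal (case z of (x, y) \<Rightarrow> f x y))"
      by (rule continuous_on_cong[THEN iffD1, OF refl _ U_cont]) (auto simp: U_eq)
    then show "continuous_on (closure \<Lambda> \<times> closure \<Lambda>) (\<lambda>(x, y). f x y)"
      unfolding continuous_on_def lim_ereal .
  qed (use assms False in \<open>auto simp: f_def real_of_ereal_pos\<close>)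
  then interpret confined_potential \<Lambda> f .
  define E where "E = {\<epsilon>. ground_energy \<Lambda> U < ereal \<epsilon>}"
  let ?J = "\<lambda>N. truncated_moment (configurations {1..N}) (energy N)"
  interpret S: moment_sequence "\<lambda>N. configurations {1..N}" energy E
  proof (rule moment_sequence_energy[OF discretizable])
    show "0 < e" if "e \<in> E" for e
      using that le_less_trans[OF ground_energy_nonneg, of \<Lambda> U "ereal e"] by (simp add: E_def)
    show "e' \<in> E" if "e \<in> E" "e \<le> e'" for e e'
      using that less_le_trans[of "ground_energy \<Lambda> U" "ereal e" "ereal e'"] by (simp add: E_def)
    show "\<exists>d>0. e - d \<in> E" if "e \<in> E" for e
    proof -
      have "ground_energy \<Lambda> U < ereal e" using that by (simp add: E_def)
      from ereal_dense2[OF this] obtain x where "ground_energy \<Lambda> U < ereal x" "ereal x < ereal e" by blast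
      then show ?thesis by (intro exI[of _ "e - x"]) (auto simp: E_def)
    qed
    show "0 < measure (configurations {1..N}) {q \<in> space (configurations {1..N}). energy N q < e}"
      if e: "e \<in> E" and N: "1 \<le> N" for e N
    proof -
      \<comment> \<open>A measure with mean-field energy below \<open>e\<close> yields, for every
        \<open>N\<close>, a configuration below \<open>e\<close>, and continuity turns that into
        positive probability.\<close>
      obtain \<mu> where \<mu>: "prob_space \<mu>" "sets \<mu> = sets (restrict_space borel \<Lambda>)"
        and less: "enn2ereal (\<integral>\<^sup>+ x. \<integral>\<^sup>+ y. e2ennreal (1 / 2 * U x y) \<partial>\<mu> \<partial>\<mu>) < ereal e"
        using e by (auto simp: E_def ground_energy_def INF_less_iff prob_measures_on_def)
      have space: "space \<mu> = \<Lambda>" using sets_eq_imp_space_eq[OF \<mu>(2)] by (simp add: space_restrict_space)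
      have "(\<integral>\<^sup>+ x. \<integral>\<^sup>+ y. e2ennreal (1 / 2 * U x y) \<partial>\<mu> \<partial>\<mu>) = (\<integral>\<^sup>+ x. \<integral>\<^sup>+ y. ennreal (1 / 2 * f x y) \<partial>\<mu> \<partial>\<mu>)"
      proof (intro nn_integral_cong)
        fix x y assume "x \<in> space \<mu>" "y \<in> space \<mu>"
        then have "U x y = ereal (f x y)" using closure_subset[of \<Lambda>] by (intro U_eq) (auto simp: space)
        then show "e2ennreal (1 / 2 * U x y) = ennreal (1 / 2 * f x y)"
          by (simp add: e2ennreal_ereal one_ereal_def numeral_eq_ereal)
      qed
      then have "enn2ereal (\<integral>\<^sup>+ x. \<integral>\<^sup>+ y. ennreal (1 / 2 * f x y) \<partial>\<mu> \<partial>\<mu>) < ereal e" using less by simp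
      then have "(\<integral>\<^sup>+ x. \<integral>\<^sup>+ y. ennreal (1 / 2 * f x y) \<partial>\<mu> \<partial>\<mu>) < ennreal e"
        by (cases "\<integral>\<^sup>+ x. \<integral>\<^sup>+ y. ennreal (1 / 2 * f x y) \<partial>\<mu> \<partial>\<mu>" rule: ennreal_cases)
          (auto simp: ennreal_less_iff enn2ereal_ennreal)
      from low_energy_configuration[OF \<mu> this N] obtain x where "\<forall>i\<in>{1..N}. x i \<in> \<Lambda>" "energy N x < e" by blast
      then show ?thesis using N by (intro energy_less_prob_pos) auto
    qed
  qed
  obtain s where s: "\<And>e. e \<in> E \<Longrightarrow> (\<lambda>N. S.rate N e) \<longlonglongrightarrow> s e" "continuous_on E s" "strict_mono_on E s"
    using S.rate_limit by blast
  obtain c where c: "(\<lambda>N. (ln (phase_const N * (3 * real N / 2) / (real N)\<^sup>2) + real N * ln (real N)) / real N) \<longlonglongrightarrow> c"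
    using ln_phase_const_asymp[OF cp] by blast
  have deriv: "(phase_volume \<Lambda> U N has_real_derivative
      phase_const N * (3 * real N / 2) / (real N)\<^sup>2 * ?J N (3 * real N / 2 - 1) e) (at ((real N)\<^sup>2 * e))"
    if N: "1 \<le> N" for N e
  proof -
    interpret V: nonneg_variable "configurations {1..N}" "energy N" by (rule nonneg_variable_energy)
    have "phase_volume \<Lambda> U N = (\<lambda>e. phase_const N * ?J N (3 * real N / 2) (e / (real N)\<^sup>2))"
      using phase_volume_eq[OF cp U_eq N] closure_subset[of \<Lambda>] by (auto simp: fun_eq_iff subset_iff)
    moreover have "((\<lambda>e. ?J N (3 * real N / 2) (e / (real N)\<^sup>2)) has_real_derivative
        3 * real N / 2 * ?J N (3 * real N / 2 - 1) e * (1 / (real N)\<^sup>2)) (at ((real N)\<^sup>2 * e))"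
    proof (rule DERIV_chain2[where f = "?J N (3 * real N / 2)" and g = "\<lambda>e. e / (real N)\<^sup>2"])
      show "(?J N (3 * real N / 2) has_real_derivative 3 * real N / 2 * ?J N (3 * real N / 2 - 1) e)
          (at ((real N)\<^sup>2 * e / (real N)\<^sup>2))"
        using N V.has_real_derivative_truncated_moment[of "3 * real N / 2" e] by simp
      show "((\<lambda>e. e / (real N)\<^sup>2) has_real_derivative 1 / (real N)\<^sup>2) (at ((real N)\<^sup>2 * e))"
        by (rule DERIV_cdivide) simp
    qed
    from DERIV_cmult[OF this, of "phase_const N"]
    have "((\<lambda>e. phase_const N * ?J N (3 * real N / 2) (e / (real N)\<^sup>2)) has_real_derivative
        phase_const N * (3 * real N / 2) / (real N)\<^sup>2 * ?J N (3 * real N / 2 - 1) e) (at ((real N)\<^sup>2 * e))"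
      by (simp add: mult_ac)
    ultimately show ?thesis by simp
  qed
  have pos: "0 < phase_const N * (3 * real N / 2) / (real N)\<^sup>2" if "1 \<le> N" for N
    using phase_const_pos[OF that] that by simp
  have Jpos: "0 < ?J N (3 * real N / 2 - 1) e" if "e \<in> E" "1 \<le> N" for N e
    using that by (intro S.moment_pos) auto
  show ?thesis
  \<comment> \<open>The entropy per particle is the constant \<open>c\<close> from the explicit
    prefactors plus the limiting rate of the moments, which alone depends on \<epsilon>.\<close>
  proof (intro exI[of _ "\<lambda>e. c + s e"] conjI allI impI)
    fix \<epsilon> assume "ground_energy \<Lambda> U < ereal \<epsilon>"
    then have \<epsilon>: "\<epsilon> \<in> E" by (simp add: E_def)
    show "phase_volume \<Lambda> U N differentiable at ((real N)\<^sup>2 * \<epsilon>)" if "1 \<le> N" for N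
      using deriv[OF that] by (auto simp: real_differentiable_def)
    show "0 < deriv (phase_volume \<Lambda> U N) ((real N)\<^sup>2 * \<epsilon>)" if "1 \<le> N" for N
      unfolding DERIV_imp_deriv[OF deriv[OF that]] using pos[OF that] Jpos[OF \<epsilon> that] by (rule mult_pos_pos)
    show "(\<lambda>N. ergodic_entropy \<Lambda> U N ((real N)\<^sup>2 * \<epsilon>) - (- real N * ln (real N) + real N * (c + s \<epsilon>))) \<in> o(\<lambda>N. real N)"
    proof (rule smalloI_tendsto)
      have "(\<lambda>N. (ln (phase_const N * (3 * real N / 2) / (real N)\<^sup>2) + real N * ln (real N)) / real N
          + S.rate N \<epsilon> - (c + s \<epsilon>)) \<longlonglongrightarrow> c + s \<epsilon> - (c + s \<epsilon>)"
        by (intro tendsto_intros c s(1) \<epsilon>)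
      moreover have "\<forall>\<^sub>F N in sequentially. (ln (phase_const N * (3 * real N / 2) / (real N)\<^sup>2) + real N * ln (real N)) / real N
          + S.rate N \<epsilon> - (c + s \<epsilon>)
          = (ergodic_entropy \<Lambda> U N ((real N)\<^sup>2 * \<epsilon>) - (- real N * ln (real N) + real N * (c + s \<epsilon>))) / real N"
        using eventually_ge_at_top[of 1]
      proof eventually_elim
        case (elim N)
        have "ergodic_entropy \<Lambda> U N ((real N)\<^sup>2 * \<epsilon>) = ln (phase_const N * (3 * real N / 2) / (real N)\<^sup>2) + real N * S.rate N \<epsilon>"
          unfolding ergodic_entropy_def DERIV_imp_deriv[OF deriv[OF elim]] S.rate_def
            ln_mult_pos[OF pos[OF elim] Jpos[OF \<epsilon> elim]] using elim by simp
        then show ?case using elim by (simp add: field_simps)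
      qed
      ultimately show "(\<lambda>N. (ergodic_entropy \<Lambda> U N ((real N)\<^sup>2 * \<epsilon>) - (- real N * ln (real N) + real N * (c + s \<epsilon>))) / real N) \<longlonglongrightarrow> 0"
        using Lim_transform_eventually by fastforce
    qed (auto intro: eventually_sequentiallyI[of 1])
  next
    show "continuous_on {\<epsilon>. ground_energy \<Lambda> U < ereal \<epsilon>} (\<lambda>e. c + s e)"
      using s(2) unfolding E_def by (intro continuous_intros)
    show "strict_mono_on {\<epsilon>. ground_energy \<Lambda> U < ereal \<epsilon>} (\<lambda>e. c + s e)"
      using s(3) unfolding E_def by (auto simp: strict_mono_on_def)
  qed
qed

end
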